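(* If $U\subset\mathbb{C}$ is an unbounded domain whose boundary is a bounded quasicircle, then $U$ is Schwartz equivalent to $\mathbb{C}\setminus\overline{\mathbb{D}}$, where $\mathbb{D}$ is the open unit disc.
   Context: A domain is an open connected subset of $\mathbb{C}$. Identify $\mathbb{C}$ with $\mathbb{R}^2$. $\mathcal{S}(\mathbb{R}^n)$ is the usual Fréchet space of real-valued Schwartz functions on $\mathbb{R}^n$. For an open $U\subset\mathbb{R}^n$, $\mathcal{S}(U)$ is the closed subspace of those $f\in\mathcal{S}(\mathbb{R}^n)$ such that $f$ and all its partial derivatives vanish at every point of $\mathbb{R}^n\setminus U$, with the induced Fréchet topology; its elements are regarded (by restriction) as smooth functions on $U$. Two open subsets $U,V\subset\mathbb{R}^n$ are called Schwartz equivalent if there exists a $C^\infty$-diffeomorphism $\phi\colon U\to V$ such that $s\mapsto s\circ\phi$ is an isomorphism of Fréchet spaces $\mathcal{S}(V)\to\mathcal{S}(U)$. A closed subset $J^0\subset\mathbb{C}$ is a quasicircle if its closure in the Riemann sphere $\widehat{\mathbb{C}}$ is a Jordan curve and there is $C>0$ such that for all distinct $x,y\in J^0$ the smallest diameter of a connected component of $J^0\setminus\{x,y\}$ is at most $C|x-y|$. *)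

theory Defs
  imports "HOL-Analysis.Analysis"
begin

text \<open>\<open>\<real>\<^sup>n\<close> is rendered as an arbitrary \<^class>\<open>euclidean_space\<close>, the coordinates being taken with respect
  to \<^const>\<open>Basis\<close>. On \<^typ>\<open>complex\<close>, \<^const>\<open>Basis\<close> is \<open>{1, \<i>}\<close>, which is the usual
  identification of the complex plane with \<open>\<real>\<^sup>2\<close>.\<close>

section \<open>Smooth functions and diffeomorphisms\<close>

text \<open>\<open>iter_pd [b\<^sub>1, \<dots>, b\<^sub>m] f\<close> is \<open>\<partial>\<^bsub>b\<^sub>1\<^esub> \<dots> \<partial>\<^bsub>b\<^sub>m\<^esub> f\<close>. It is only meaningful where
  the lower-order derivatives are differentiable, as \<^const>\<open>frechet_derivative\<close> is
  unspecified elsewhere.\<close>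

primrec iter_pd ::
  "'a::euclidean_space list \<Rightarrow> ('a \<Rightarrow> 'b::real_normed_vector) \<Rightarrow> 'a \<Rightarrow> 'b" where
  "iter_pd [] f = f"
| "iter_pd (b # bs) f = (\<lambda>x. frechet_derivative (iter_pd bs f) (at x) b)"

text \<open>Intended for open \<open>U\<close>. Requiring every iterated partial derivative to be (totally)
  differentiable amounts to requiring that all of them exist and are continuous.\<close>

definition smooth_on :: "'a::euclidean_space set \<Rightarrow> ('a \<Rightarrow> 'b::real_normed_vector) \<Rightarrow> bool" where
  "smooth_on U f \<longleftrightarrow> (\<forall>bs\<in>lists Basis. \<forall>x\<in>U. iter_pd bs f differentiable (at x))"

definition diffeomorphism ::
  "'a::euclidean_space set \<Rightarrow> 'b::euclidean_space set \<Rightarrow> ('a \<Rightarrow> 'b) \<Rightarrow> bool" where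
  "diffeomorphism U V \<phi> \<longleftrightarrow>
     bij_betw \<phi> U V \<and> smooth_on U \<phi> \<and> smooth_on V (inv_into U \<phi>)"


section \<open>Schwartz spaces\<close>

definition schwartz_space :: "('a::euclidean_space \<Rightarrow> real) set" where
  "schwartz_space = {f. smooth_on UNIV f \<and>
     (\<forall>k. \<forall>bs\<in>lists Basis. bdd_above (range (\<lambda>x. norm x ^ k * \<bar>iter_pd bs f x\<bar>)))}"

definition schwartz_seminorm ::
  "nat \<Rightarrow> 'a::euclidean_space list \<Rightarrow> ('a \<Rightarrow> real) \<Rightarrow> real" where
  "schwartz_seminorm k bs f = (SUP x. norm x ^ k * \<bar>iter_pd bs f x\<bar>)"

text \<open>The Frechet topology: open seminorm balls, around all points and for all seminorms,
  form a subbase.\<close>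

definition schwartz_topology :: "('a::euclidean_space \<Rightarrow> real) topology" where
  "schwartz_topology = topology_generated_by
     {{g \<in> schwartz_space. schwartz_seminorm k bs (\<lambda>x. g x - f x) < e} | f k bs e.
        f \<in> schwartz_space \<and> bs \<in> lists Basis \<and> 0 < e}"

definition schwartz_space_on :: "'a::euclidean_space set \<Rightarrow> ('a \<Rightarrow> real) set" where
  "schwartz_space_on U =
     {f \<in> schwartz_space. \<forall>bs\<in>lists Basis. \<forall>x\<in>- U. iter_pd bs f x = 0}"

definition schwartz_topology_on :: "'a::euclidean_space set \<Rightarrow> ('a \<Rightarrow> real) topology" where
  "schwartz_topology_on U = subtopology schwartz_topology (schwartz_space_on U)"

lemma topspace_schwartz_topology [simp]: "topspace schwartz_topology = schwartz_space"
proof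
  show "topspace schwartz_topology \<subseteq> (schwartz_space :: ('a \<Rightarrow> real) set)"
    unfolding schwartz_topology_def topology_generated_by_topspace by blast
  show "(schwartz_space :: ('a \<Rightarrow> real) set) \<subseteq> topspace schwartz_topology"
  proof
    fix f :: "'a \<Rightarrow> real" assume f: "f \<in> schwartz_space"
    let ?B = "{g \<in> schwartz_space. schwartz_seminorm 0 [] (\<lambda>x. g x - f x) < 1}"
    have "f \<in> ?B"
      using f by (simp add: schwartz_seminorm_def)
    moreover have "openin schwartz_topology ?B"
      unfolding schwartz_topology_def
      by (rule topology_generated_by_Basis, rule CollectI,
          rule exI[of _ f], rule exI[of _ 0], rule exI[of _ "[]"], rule exI[of _ 1])
         (simp add: f)
    ultimately show "f \<in> topspace schwartz_topology"
      using openin_subset by blast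
  qed
qed

lemma topspace_schwartz_topology_on [simp]:
  "topspace (schwartz_topology_on U) = schwartz_space_on U"
  by (auto simp: schwartz_topology_on_def schwartz_space_on_def)

definition schwartz_iso ::
  "'a::euclidean_space set \<Rightarrow> 'b::euclidean_space set \<Rightarrow> (('a \<Rightarrow> real) \<Rightarrow> ('b \<Rightarrow> real)) \<Rightarrow> bool" where
  "schwartz_iso V U T \<longleftrightarrow>
     (\<forall>s\<in>schwartz_space_on V. \<forall>t\<in>schwartz_space_on V. \<forall>a b.
        T (\<lambda>y. a * s y + b * t y) = (\<lambda>x. a * T s x + b * T t x)) \<and>
     homeomorphic_map (schwartz_topology_on V) (schwartz_topology_on U) T"

text \<open>Elements of \<^term>\<open>schwartz_space_on U\<close> are total functions vanishing off \<open>U\<close>, so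
  \<open>s \<circ> \<phi>\<close>, which is a function on \<open>U\<close>, stands for its extension by zero.\<close>

definition pullback :: "'a set \<Rightarrow> ('a \<Rightarrow> 'b) \<Rightarrow> ('b \<Rightarrow> real) \<Rightarrow> 'a \<Rightarrow> real" where
  "pullback U \<phi> s = (\<lambda>x. if x \<in> U then s (\<phi> x) else 0)"

definition schwartz_equivalent :: "'a::euclidean_space set \<Rightarrow> 'a set \<Rightarrow> bool" where
  "schwartz_equivalent U V \<longleftrightarrow> open U \<and> open V \<and>
     (\<exists>\<phi>. diffeomorphism U V \<phi> \<and> schwartz_iso V U (pullback U \<phi>))"


section \<open>Quasicircles\<close>

abbreviation riemann_sphere :: "complex option topology" where
  "riemann_sphere \<equiv> Alexandroff_compactification euclidean"

definition jordan_curve_in :: "'a topology \<Rightarrow> 'a set \<Rightarrow> bool" where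
  "jordan_curve_in X S \<longleftrightarrow> S \<subseteq> topspace X \<and>
     subtopology X S homeomorphic_space top_of_set (sphere (0::complex) 1)"

text \<open>The conjunct \<^term>\<open>bounded K\<close> is needed because \<^const>\<open>diameter\<close> is real-valued and
  unspecified on unbounded sets, which should have infinite diameter.\<close>

definition quasicircle :: "complex set \<Rightarrow> bool" where
  "quasicircle J \<longleftrightarrow> closed J \<and>
     jordan_curve_in riemann_sphere (riemann_sphere closure_of (Some ` J)) \<and>
     (\<exists>C>0. \<forall>x\<in>J. \<forall>y\<in>J. x \<noteq> y \<longrightarrow>
        (\<exists>K\<in>components (J - {x, y}). bounded K \<and> diameter K \<le> C * dist x y))"

end

(* The map is the Riemann map phi of U onto the exterior of the disc. Cauchy's inequalities bound its
   derivatives by negative powers of the distance d to the boundary, and these are compensated by the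
   flatness of Schwartz functions once phi and its inverse psi are Hoelder continuous up to the
   boundary, in the weak sense that dist(phi z, unit circle)^N <= C d(z), and likewise for psi.

   For phi this needs no geometry: for p outside U, a logarithm of f - p, f the Riemann map of the
   inverted domain, omits translates by 2 pi i, so Bloch's theorem bounds its derivative by a multiple
   of 1/(1 - |t|), and integration gives |f(t) - p| >= |f(0) - p| (1 - |t|)^96.

   For psi the quasicircle condition enters. Janiszewski's theorem, applied to J = frontier U and small
   discs centred on J that are added one at a time, joins each w in U to a far away point by a path on
   which the distance to J is at least a fixed multiple of the distance to w. Such a path is covered by
   O(log(1/d(w))) discs of comparable size, so Harnack's inequality for ln |phi| gives
   |phi(w)| - 1 >= c d(w)^M. *)

theory Submission
  imports Defs "HOL-Complex_Analysis.Complex_Analysis"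
begin

section \<open>Iterated partial derivatives and Schwartz seminorms\<close>

text \<open>A function in the Schwartz space of the target vanishes to infinite order at the
  boundary and absorbs any fixed negative power of the distance, so only the existence of exponents
  matters and all constants may be crude. The delicate direction is the lower bound for |\<phi>| -
  1: ln |\<phi>| is the Green function of U with pole at infinity, and in a cusp of U it can decay
  faster than every power of the distance. Such cusps are what the two-point condition on J
  excludes. Janiszewski's theorem requires two sets with connected intersection, but a disc centred
  on J may meet J in many pieces; bounded turning supplies a connected piece of J of comparable size
  that can be joined to the disc. Infinity causes no loss: inversion makes it an interior point,
  where the Schwarz lemma gives linear growth of \<phi> and \<psi>. Higher chain rules enter through
  classes of expressions that are closed under differentiation and whose coefficients do not depend
  on the Schwartz function; this uniformity turns pointwise estimates into continuity of the
  pullback.\<close>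

lemma frechet_derivative_cong_open:
  assumes "open U" "x \<in> U" "\<And>y. y \<in> U \<Longrightarrow> f y = g y"
  shows "frechet_derivative f (at x) = frechet_derivative g (at x)"
proof -
  have "(f has_derivative f') (at x) \<longleftrightarrow> (g has_derivative f') (at x)" for f'
    using has_derivative_transform_within_open[OF _ assms(1,2)] assms(3) by metis
  then show ?thesis
    unfolding frechet_derivative_def by simp
qed

lemma differentiable_cong_open:
  assumes "open U" "x \<in> U" "\<And>y. y \<in> U \<Longrightarrow> f y = g y"
  shows "f differentiable (at x) \<longleftrightarrow> g differentiable (at x)"
  using has_derivative_transform_within_open[OF _ assms(1,2)] assms(3)
  unfolding differentiable_def by metis

lemma iter_pd_cong_open:
  assumes "open U" "x \<in> U" "\<And>y. y \<in> U \<Longrightarrow> f y = g y"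
  shows "iter_pd bs f x = iter_pd bs g x"
  using assms(2)
proof (induction bs arbitrary: x)
  case Nil
  then show ?case using assms(3) by simp
next
  case (Cons b bs)
  show ?case
    using frechet_derivative_cong_open[OF assms(1) Cons.prems Cons.IH] by simp
qed

lemma smooth_on_cong_open:
  assumes "open U" "\<And>y. y \<in> U \<Longrightarrow> f y = g y" "smooth_on U f"
  shows "smooth_on U g"
  unfolding smooth_on_def
proof (intro ballI)
  fix bs :: "'a list" and x
  assume "bs \<in> lists Basis" "x \<in> U"
  then have "iter_pd bs f differentiable (at x)"
    using assms(3) by (auto simp: smooth_on_def)
  then show "iter_pd bs g differentiable (at x)"
    using differentiable_cong_open[OF assms(1) \<open>x \<in> U\<close>, of "iter_pd bs f" "iter_pd bs g"]
      iter_pd_cong_open[OF assms(1) _ assms(2)] by simp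
qed

lemma has_derivative_frechet:
  "f differentiable (at x) \<Longrightarrow> (f has_derivative frechet_derivative f (at x)) (at x)"
  using frechet_derivative_works by blast

lemma iter_pd_has_derivative:
  assumes "smooth_on U f" "bs \<in> lists Basis" "x \<in> U"
  shows "(iter_pd bs f has_derivative frechet_derivative (iter_pd bs f) (at x)) (at x)"
  using assms by (auto simp: smooth_on_def intro: has_derivative_frechet)

lemma frechet_derivative_eq_sum_iter_pd:
  fixes f :: "'a::euclidean_space \<Rightarrow> 'b::real_normed_vector"
  assumes "smooth_on U f" "bs \<in> lists Basis" "x \<in> U"
  shows "frechet_derivative (iter_pd bs f) (at x) h = (\<Sum>b\<in>Basis. (h \<bullet> b) *\<^sub>R iter_pd (b # bs) f x)"
proof -
  interpret D: bounded_linear "frechet_derivative (iter_pd bs f) (at x)"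
    using iter_pd_has_derivative[OF assms] by (rule has_derivative_bounded_linear)
  have "frechet_derivative (iter_pd bs f) (at x) h
      = frechet_derivative (iter_pd bs f) (at x) (\<Sum>b\<in>Basis. (h \<bullet> b) *\<^sub>R b)"
    by (simp add: euclidean_representation)
  also have "\<dots> = (\<Sum>b\<in>Basis. (h \<bullet> b) *\<^sub>R iter_pd (b # bs) f x)"
    by (simp add: D.sum D.scaleR)
  finally show ?thesis .
qed

section \<open>Linearity of iterated derivatives and the seminorms\<close>

lemma iter_pd_linear_combination:
  fixes f g :: "'a::euclidean_space \<Rightarrow> real"
  assumes "smooth_on UNIV f" "smooth_on UNIV g" "bs \<in> lists Basis"
  shows "iter_pd bs (\<lambda>x. a * f x + b * g x) = (\<lambda>x. a * iter_pd bs f x + b * iter_pd bs g x)"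
  using assms(3)
proof (induction bs)
  case (Cons c bs)
  then have bs: "bs \<in> lists Basis" by simp
  show ?case
  proof
    fix x
    have "((\<lambda>x. a * iter_pd bs f x + b * iter_pd bs g x) has_derivative
        (\<lambda>h. a * frechet_derivative (iter_pd bs f) (at x) h + b * frechet_derivative (iter_pd bs g) (at x) h)) (at x)"
      by (intro has_derivative_add has_derivative_mult_right iter_pd_has_derivative[OF assms(1) bs]
          iter_pd_has_derivative[OF assms(2) bs]) auto
    then show "iter_pd (c # bs) (\<lambda>x. a * f x + b * g x) x
        = a * iter_pd (c # bs) f x + b * iter_pd (c # bs) g x"
      using Cons.IH by (simp add: frechet_derivative_at[symmetric])
  qed
qed simp

lemma smooth_on_linear_combination:
  fixes f g :: "'a::euclidean_space \<Rightarrow> real"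
  assumes "smooth_on UNIV f" "smooth_on UNIV g"
  shows "smooth_on UNIV (\<lambda>x. a * f x + b * g x)"
  unfolding smooth_on_def
proof (intro ballI)
  fix bs :: "'a list" and x :: 'a
  assume bs: "bs \<in> lists Basis"
  have "(\<lambda>x. a * iter_pd bs f x + b * iter_pd bs g x) differentiable (at x)"
    using assms bs unfolding smooth_on_def by (intro differentiable_add differentiable_mult) auto
  then show "iter_pd bs (\<lambda>x. a * f x + b * g x) differentiable (at x)"
    by (simp only: iter_pd_linear_combination[OF assms bs])
qed

lemma schwartz_smooth: "s \<in> schwartz_space \<Longrightarrow> smooth_on UNIV s"
  by (simp add: schwartz_space_def)

lemma schwartz_seminorm_upper:
  assumes "s \<in> schwartz_space" "bs \<in> lists Basis"
  shows "norm x ^ k * \<bar>iter_pd bs s x\<bar> \<le> schwartz_seminorm k bs s"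
  unfolding schwartz_seminorm_def
  by (rule cSUP_upper) (use assms in \<open>auto simp: schwartz_space_def\<close>)

lemma schwartz_seminorm_least:
  assumes "\<And>x. norm x ^ k * \<bar>iter_pd bs s x\<bar> \<le> B"
  shows "schwartz_seminorm k bs s \<le> B"
  unfolding schwartz_seminorm_def by (rule cSUP_least) (use assms in auto)

lemma schwartz_seminorm_nonneg:
  assumes "s \<in> schwartz_space" "bs \<in> lists Basis"
  shows "0 \<le> schwartz_seminorm k bs s"
  by (rule order_trans[OF _ schwartz_seminorm_upper[OF assms, of 0]]) simp

lemma weighted_linear_combination_bound:
  assumes "f \<in> schwartz_space" "g \<in> schwartz_space" "bs \<in> lists Basis"
  shows "norm x ^ k * \<bar>iter_pd bs (\<lambda>x. a * f x + b * g x) x\<bar>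
    \<le> \<bar>a\<bar> * schwartz_seminorm k bs f + \<bar>b\<bar> * schwartz_seminorm k bs g"
proof -
  have "norm x ^ k * \<bar>iter_pd bs (\<lambda>x. a * f x + b * g x) x\<bar>
      = norm x ^ k * \<bar>a * iter_pd bs f x + b * iter_pd bs g x\<bar>"
    by (simp add: iter_pd_linear_combination assms schwartz_smooth)
  also have "\<dots> \<le> norm x ^ k * (\<bar>a\<bar> * \<bar>iter_pd bs f x\<bar> + \<bar>b\<bar> * \<bar>iter_pd bs g x\<bar>)"
    by (intro mult_left_mono order_trans[OF abs_triangle_ineq]) (auto simp: abs_mult)
  also have "\<dots> = \<bar>a\<bar> * (norm x ^ k * \<bar>iter_pd bs f x\<bar>) + \<bar>b\<bar> * (norm x ^ k * \<bar>iter_pd bs g x\<bar>)"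
    by (simp add: algebra_simps)
  also have "\<dots> \<le> \<bar>a\<bar> * schwartz_seminorm k bs f + \<bar>b\<bar> * schwartz_seminorm k bs g"
    by (intro add_mono mult_left_mono schwartz_seminorm_upper assms) auto
  finally show ?thesis .
qed

lemma schwartz_seminorm_linear_combination:
  assumes "f \<in> schwartz_space" "g \<in> schwartz_space" "bs \<in> lists Basis"
  shows "schwartz_seminorm k bs (\<lambda>x. a * f x + b * g x)
    \<le> \<bar>a\<bar> * schwartz_seminorm k bs f + \<bar>b\<bar> * schwartz_seminorm k bs g"
  by (rule schwartz_seminorm_least) (rule weighted_linear_combination_bound[OF assms])

lemma schwartz_linear_combination:
  assumes "f \<in> schwartz_space" "g \<in> schwartz_space"
  shows "(\<lambda>x. a * f x + b * g x) \<in> schwartz_space"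
  unfolding schwartz_space_def[where 'a='a]
proof (intro CollectI conjI allI ballI)
  show "smooth_on UNIV (\<lambda>x. a * f x + b * g x)"
    by (intro smooth_on_linear_combination schwartz_smooth assms)
  show "bdd_above (range (\<lambda>x. norm x ^ k * \<bar>iter_pd bs (\<lambda>x. a * f x + b * g x) x\<bar>))"
    if "bs \<in> lists Basis" for k bs
    by (rule bdd_aboveI2[OF weighted_linear_combination_bound[OF assms that]])
qed

lemma schwartz_on_imp_schwartz: "s \<in> schwartz_space_on V \<Longrightarrow> s \<in> schwartz_space"
  by (simp add: schwartz_space_on_def)

lemma schwartz_on_linear_combination:
  assumes "f \<in> schwartz_space_on V" "g \<in> schwartz_space_on V"
  shows "(\<lambda>x. a * f x + b * g x) \<in> schwartz_space_on V"
  using assms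
  by (auto simp: schwartz_space_on_def schwartz_linear_combination iter_pd_linear_combination schwartz_smooth)

lemma schwartz_diff:
  assumes "f \<in> schwartz_space" "g \<in> schwartz_space"
  shows "(\<lambda>x. f x - g x) \<in> schwartz_space"
  using schwartz_linear_combination[OF assms, of 1 "-1"] by simp

text \<open>Stands in for a continuous seminorm. The estimates below produce functionals built by
  sums and scalings, and recording only that finitely many defining seminorms suffice spares the
  bookkeeping of indices.\<close>

definition schwartz_dominated :: "(('a::euclidean_space \<Rightarrow> real) \<Rightarrow> real) \<Rightarrow> bool" where
  "schwartz_dominated p \<longleftrightarrow> (\<exists>C\<ge>0. \<exists>Q. finite Q \<and> Q \<subseteq> UNIV \<times> lists Basis \<and>
     (\<forall>s\<in>schwartz_space. 0 \<le> p s \<and> p s \<le> C * (\<Sum>q\<in>Q. schwartz_seminorm (fst q) (snd q) s)))"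

lemma schwartz_dominatedE:
  assumes "schwartz_dominated p"
  obtains C Q where "C \<ge> 0" "finite Q" "Q \<subseteq> UNIV \<times> lists Basis"
    "\<And>s. s \<in> schwartz_space \<Longrightarrow> p s \<le> C * (\<Sum>q\<in>Q. schwartz_seminorm (fst q) (snd q) s)"
  using assms unfolding schwartz_dominated_def Bex_def by (elim exE conjE) (rule that, auto)

lemma schwartz_dominated_nonneg: "schwartz_dominated p \<Longrightarrow> s \<in> schwartz_space \<Longrightarrow> 0 \<le> p s"
  by (auto simp: schwartz_dominated_def)

lemma schwartz_dominatedI:
  assumes "C \<ge> 0" "finite Q" "Q \<subseteq> UNIV \<times> lists Basis"
    "\<And>s. s \<in> schwartz_space \<Longrightarrow> p s \<le> C * (\<Sum>q\<in>Q. schwartz_seminorm (fst q) (snd q) s)"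
    "\<And>s. s \<in> schwartz_space \<Longrightarrow> 0 \<le> p s"
  shows "schwartz_dominated p"
  unfolding schwartz_dominated_def by (intro exI[of _ C] exI[of _ Q] conjI ballI assms)

lemma schwartz_dominated_seminorm:
  assumes "bs \<in> lists Basis"
  shows "schwartz_dominated (schwartz_seminorm k bs)"
  by (rule schwartz_dominatedI[of 1 "{(k, bs)}"]) (use assms schwartz_seminorm_nonneg in auto)

lemma schwartz_dominated_scale:
  assumes "schwartz_dominated p" "0 \<le> c"
  shows "schwartz_dominated (\<lambda>s. c * p s)"
proof -
  obtain C Q where C: "C \<ge> 0" "finite Q" "Q \<subseteq> UNIV \<times> lists Basis"
    "\<And>s. s \<in> schwartz_space \<Longrightarrow> p s \<le> C * (\<Sum>q\<in>Q. schwartz_seminorm (fst q) (snd q) s)"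
    by (rule schwartz_dominatedE[OF assms(1)], rule that)
  have "c * p s \<le> (c * C) * (\<Sum>q\<in>Q. schwartz_seminorm (fst q) (snd q) s)" if "s \<in> schwartz_space" for s
    using mult_left_mono[OF C(4)[OF that] assms(2)] by (simp add: mult.assoc)
  then show ?thesis
    by (intro schwartz_dominatedI[of "c * C" Q]) (use C(1-3) assms(2) schwartz_dominated_nonneg[OF assms(1)] in auto)
qed

lemma schwartz_dominated_add:
  assumes "schwartz_dominated p" "schwartz_dominated q"
  shows "schwartz_dominated (\<lambda>s. p s + q s)"
proof -
  obtain C Q where C: "C \<ge> 0" "finite Q" "Q \<subseteq> UNIV \<times> lists Basis"
    "\<And>s. s \<in> schwartz_space \<Longrightarrow> p s \<le> C * (\<Sum>q\<in>Q. schwartz_seminorm (fst q) (snd q) s)"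
    by (rule schwartz_dominatedE[OF assms(1)], rule that)
  obtain D R where D: "D \<ge> 0" "finite R" "R \<subseteq> UNIV \<times> lists Basis"
    "\<And>s. s \<in> schwartz_space \<Longrightarrow> q s \<le> D * (\<Sum>q\<in>R. schwartz_seminorm (fst q) (snd q) s)"
    by (rule schwartz_dominatedE[OF assms(2)], rule that)
  have "p s + q s \<le> (C + D) * (\<Sum>q\<in>Q \<union> R. schwartz_seminorm (fst q) (snd q) s)"
    if s: "s \<in> schwartz_space" for s
  proof -
    have "(\<Sum>q\<in>Q. schwartz_seminorm (fst q) (snd q) s) \<le> (\<Sum>q\<in>Q \<union> R. schwartz_seminorm (fst q) (snd q) s)"
         "(\<Sum>q\<in>R. schwartz_seminorm (fst q) (snd q) s) \<le> (\<Sum>q\<in>Q \<union> R. schwartz_seminorm (fst q) (snd q) s)"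
      using C D by (auto intro!: sum_mono2 schwartz_seminorm_nonneg s)
    then show ?thesis
      using C(4)[OF s] D(4)[OF s] C(1) D(1)
      by (smt (verit) distrib_right mult_left_mono)
  qed
  then show ?thesis
    by (intro schwartz_dominatedI[of "C + D" "Q \<union> R"]) (use C(1-3) D(1-3) assms[THEN schwartz_dominated_nonneg] in auto)
qed

lemma schwartz_dominated_0: "schwartz_dominated (\<lambda>s. 0)"
  by (rule schwartz_dominatedI[of 0 "{}"]) auto

lemma schwartz_dominated_sum:
  assumes "finite A" "\<And>a. a \<in> A \<Longrightarrow> schwartz_dominated (p a)"
  shows "schwartz_dominated (\<lambda>s. \<Sum>a\<in>A. p a s)"
  using assms by (induction A) (auto intro: schwartz_dominated_0 schwartz_dominated_add)

section \<open>Neighbourhoods and a criterion for continuity\<close>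

lemma openin_schwartz_ball:
  assumes "f \<in> schwartz_space" "bs \<in> lists Basis" "0 < e"
  shows "openin schwartz_topology {g \<in> schwartz_space. schwartz_seminorm k bs (\<lambda>x. g x - f x) < e}"
  unfolding schwartz_topology_def
  by (rule topology_generated_by_Basis, rule CollectI, rule exI[of _ f], rule exI[of _ k],
      rule exI[of _ bs], rule exI[of _ e]) (simp add: assms)

text \<open>The topology is given by a subbase, so the finite intersection of the balls for the
  seminorms in \<open>Q\<close> is a neighbourhood on which \<open>p\<close> of the difference is
  controlled.\<close>

lemma openin_schwartz_on_dominated:
  assumes p: "schwartz_dominated p" and f: "f \<in> schwartz_space" and e: "0 < e"
  obtains N where "openin schwartz_topology N" "f \<in> N"
    "\<And>g. g \<in> N \<Longrightarrow> p (\<lambda>x. g x - f x) < e"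
proof -
  obtain C Q where C: "C \<ge> 0" "finite Q" "Q \<subseteq> UNIV \<times> lists Basis"
    "\<And>s. s \<in> schwartz_space \<Longrightarrow> p s \<le> C * (\<Sum>q\<in>Q. schwartz_seminorm (fst q) (snd q) s)"
    by (rule schwartz_dominatedE[OF p], rule that)
  \<comment> \<open>The two summands 1 keep the denominator positive when \<open>C\<close> is 0 or
    \<open>Q\<close> is empty, and make the final estimate strict.\<close>
  define d where "d = e / ((C + 1) * (real (card Q) + 1))"
  have d: "d > 0" using e C(1) by (simp add: d_def)
  define N where "N = topspace schwartz_topology \<inter>
    \<Inter>((\<lambda>q. {g \<in> schwartz_space. schwartz_seminorm (fst q) (snd q) (\<lambda>x. g x - f x) < d}) ` Q)"
  show ?thesis
  proof (rule that[of N])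
    have "openin schwartz_topology
        (\<Inter>q\<in>Q. {g \<in> schwartz_space. schwartz_seminorm (fst q) (snd q) (\<lambda>x. g x - f x) < d})"
      if "Q \<noteq> {}"
      by (rule openin_INT2[OF C(2) that openin_schwartz_ball]) (use C(3) d f in auto)
    then show "openin schwartz_topology N"
      unfolding N_def by (cases "Q = {}") (auto intro!: openin_Int simp: openin_topspace[of schwartz_topology, simplified])
    have "schwartz_seminorm k bs (\<lambda>x. 0) = 0" if "bs \<in> lists Basis" for k and bs :: "'a list"
    proof -
      have "iter_pd bs (\<lambda>x. 0) = (\<lambda>x::'a. 0::real)"
        using that by (induction bs) auto
      then show ?thesis by (simp add: schwartz_seminorm_def)
    qed
    then show "f \<in> N"
      using f d C(3) by (force simp: N_def)
    fix g assume g: "g \<in> N"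
    then have gs: "g \<in> schwartz_space" by (simp add: N_def)
    have "p (\<lambda>x. g x - f x) \<le> C * (\<Sum>q\<in>Q. schwartz_seminorm (fst q) (snd q) (\<lambda>x. g x - f x))"
      by (rule C(4)) (rule schwartz_diff[OF gs f])
    also have "\<dots> \<le> C * (\<Sum>q\<in>Q. d)"
      using g by (intro mult_left_mono sum_mono) (auto simp: N_def C(1) less_imp_le)
    also have "\<dots> = C * card Q * d" by simp
    also have "\<dots> < (C + 1) * (real (card Q) + 1) * d"
    proof (rule mult_strict_right_mono[OF _ d])
      have "(C + 1) * (real (card Q) + 1) = C * card Q + C + card Q + 1" by (simp add: algebra_simps)
      then show "C * card Q < (C + 1) * (real (card Q) + 1)" using C(1) by simp
    qed
    also have "\<dots> = e" using C(1) by (simp add: d_def)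
    finally show "p (\<lambda>x. g x - f x) < e" by simp
  qed
qed

text \<open>With a subbase, only preimages of single balls have to be open, and compatibility with
  differences reduces this to one bound per seminorm. The functional \<open>p\<close> may depend on
  the seminorm but not on \<open>s\<close>.\<close>

lemma continuous_map_schwartz:
  fixes T :: "('a::euclidean_space \<Rightarrow> real) \<Rightarrow> ('b::euclidean_space \<Rightarrow> real)"
  assumes maps: "\<And>s. s \<in> schwartz_space_on V \<Longrightarrow> T s \<in> schwartz_space_on U"
    and diff: "\<And>s t. T (\<lambda>x. s x - t x) = (\<lambda>x. T s x - T t x)"
    and dom: "\<And>k bs. bs \<in> lists Basis \<Longrightarrow>
      \<exists>p. schwartz_dominated p \<and> (\<forall>s\<in>schwartz_space_on V. schwartz_seminorm k bs (T s) \<le> p s)"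
  shows "continuous_map (schwartz_topology_on V) (schwartz_topology_on U) T"
proof -
  have "continuous_map (schwartz_topology_on V) schwartz_topology T"
    unfolding schwartz_topology_def[where 'a='b]
  proof (rule continuous_on_generated_topo)
    show "T ` topspace (schwartz_topology_on V) \<subseteq>
      \<Union> {{g \<in> schwartz_space. schwartz_seminorm k bs (\<lambda>x. g x - f x) < e} |f k bs e.
         f \<in> schwartz_space \<and> bs \<in> lists Basis \<and> 0 < e}"
      using maps topspace_schwartz_topology[where 'a='b]
      unfolding schwartz_topology_def topology_generated_by_topspace
      by (auto intro: schwartz_on_imp_schwartz[OF maps])
    fix B
    assume "B \<in> {{g \<in> schwartz_space. schwartz_seminorm k bs (\<lambda>x. g x - f x) < e} |f k bs e.
      f \<in> (schwartz_space :: ('b \<Rightarrow> real) set) \<and> bs \<in> lists Basis \<and> 0 < e}"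
    then obtain f k bs e where B: "B = {g \<in> schwartz_space. schwartz_seminorm k bs (\<lambda>x. g x - f x) < e}"
      and f: "f \<in> schwartz_space" and bs: "bs \<in> lists Basis" and e: "0 < e"
      by (elim CollectE exE conjE) (rule that)
    obtain p where p: "schwartz_dominated p"
      "\<And>s. s \<in> schwartz_space_on V \<Longrightarrow> schwartz_seminorm k bs (T s) \<le> p s"
      using dom[OF bs, of k] by (elim exE conjE) (rule that, auto)
    show "openin (schwartz_topology_on V) (T -` B \<inter> topspace (schwartz_topology_on V))"
    \<comment> \<open>The centre \<open>f\<close> of the ball may lie outside the range of
      \<open>T\<close>, so openness is tested at each \<open>s\<close>: what \<open>T s\<close>
      leaves of the radius \<open>e\<close> is the room for the image of the difference.\<close>
    proof (subst openin_subopen, intro ballI)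
      fix s assume "s \<in> T -` B \<inter> topspace (schwartz_topology_on V)"
      then have s: "s \<in> schwartz_space_on V"
        and sB: "schwartz_seminorm k bs (\<lambda>x. T s x - f x) < e"
        by (auto simp: B)
      obtain N where N: "openin schwartz_topology N" "s \<in> N"
        "\<And>g. g \<in> N \<Longrightarrow> p (\<lambda>x. g x - s x) < e - schwartz_seminorm k bs (\<lambda>x. T s x - f x)"
        by (rule openin_schwartz_on_dominated[OF p(1) schwartz_on_imp_schwartz[OF s],
              of "e - schwartz_seminorm k bs (\<lambda>x. T s x - f x)"]) (use sB in simp, rule that)
      show "\<exists>W. openin (schwartz_topology_on V) W \<and> s \<in> W \<and>
          W \<subseteq> T -` B \<inter> topspace (schwartz_topology_on V)"
      proof (intro exI conjI subsetI)
        show "openin (schwartz_topology_on V) (N \<inter> schwartz_space_on V)"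
          unfolding schwartz_topology_on_def using N(1) by (auto simp: openin_subtopology)
        show "s \<in> N \<inter> schwartz_space_on V" using s N by simp
        fix g assume g: "g \<in> N \<inter> schwartz_space_on V"
        have gs: "(\<lambda>x. g x - s x) \<in> schwartz_space_on V"
          using schwartz_on_linear_combination[of g V s 1 "-1"] g s by simp
        have "schwartz_seminorm k bs (\<lambda>x. T g x - f x)
            = schwartz_seminorm k bs (\<lambda>x. 1 * (T (\<lambda>x. g x - s x)) x + 1 * (T s x - f x))"
          by (simp add: diff)
        also have "\<dots> \<le> 1 * schwartz_seminorm k bs (T (\<lambda>x. g x - s x)) + 1 * schwartz_seminorm k bs (\<lambda>x. T s x - f x)"
          using schwartz_seminorm_linear_combination[of "T (\<lambda>x. g x - s x)" "\<lambda>x. T s x - f x" bs k 1 1]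
            schwartz_on_imp_schwartz[OF maps[OF gs]] schwartz_diff[OF schwartz_on_imp_schwartz[OF maps[OF s]] f] bs
          by simp
        also have "\<dots> < e"
          using p(2)[OF gs] N(3)[of g] g by simp
        finally show "g \<in> T -` B \<inter> topspace (schwartz_topology_on V)"
          using g schwartz_on_imp_schwartz[OF maps] by (auto simp: B)
      qed
    qed
  qed
  then show ?thesis
    unfolding schwartz_topology_on_def[of U]
    by (subst continuous_map_in_subtopology) (auto simp: maps)
qed

section \<open>Flatness at the boundary\<close>

lemma schwartz_has_derivative:
  assumes "s \<in> schwartz_space" "bs \<in> lists Basis"
  shows "(iter_pd bs s has_derivative frechet_derivative (iter_pd bs s) (at x)) (at x)"
  using iter_pd_has_derivative[OF schwartz_smooth[OF assms(1)] assms(2)] by simp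

text \<open>Mean value inequality on the closed ball about \<open>z\<close> through
  \<open>x\<close>: the operator norm of the derivative is at most the sum of the bounds on the
  partial derivatives.\<close>

lemma flat_increment:
  fixes s :: "'a::euclidean_space \<Rightarrow> real"
  assumes s: "s \<in> schwartz_space" and bs: "bs \<in> lists Basis"
    and z: "iter_pd bs s z = 0"
    and B: "\<And>b y. b \<in> Basis \<Longrightarrow> dist y z \<le> dist x z \<Longrightarrow> \<bar>iter_pd (b # bs) s y\<bar> \<le> B b"
  shows "\<bar>iter_pd bs s x\<bar> \<le> (\<Sum>b\<in>Basis. B b) * dist x z"
proof -
  have "norm (iter_pd bs s x - iter_pd bs s z) \<le> (\<Sum>b\<in>Basis. B b) * norm (x - z)"
  proof (rule differentiable_bound[where S = "cball z (dist x z)"])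
    show "(iter_pd bs s has_derivative frechet_derivative (iter_pd bs s) (at y)) (at y within cball z (dist x z))" for y
      by (rule has_derivative_at_withinI) (rule schwartz_has_derivative[OF s bs])
    fix y assume y: "y \<in> cball z (dist x z)"
    show "onorm (frechet_derivative (iter_pd bs s) (at y)) \<le> (\<Sum>b\<in>Basis. B b)"
    proof (rule onorm_le)
      fix h
      have "frechet_derivative (iter_pd bs s) (at y) h = (\<Sum>b\<in>Basis. (h \<bullet> b) *\<^sub>R iter_pd (b # bs) s y)"
        by (rule frechet_derivative_eq_sum_iter_pd[OF schwartz_smooth[OF s] bs]) simp
      also have "norm \<dots> \<le> (\<Sum>b\<in>Basis. norm h * B b)"
      proof (rule sum_norm_le)
        fix b :: 'a assume b: "b \<in> Basis"
        have "\<bar>h \<bullet> b\<bar> * \<bar>iter_pd (b # bs) s y\<bar> \<le> norm h * B b"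
          using y b by (intro mult_mono B Basis_le_norm) (auto simp: dist_commute)
        then show "norm ((h \<bullet> b) *\<^sub>R iter_pd (b # bs) s y) \<le> norm h * B b"
          by (simp add: abs_mult)
      qed
      finally show "norm (frechet_derivative (iter_pd bs s) (at y) h) \<le> (\<Sum>b\<in>Basis. B b) * norm h"
        by (simp add: sum_distrib_left mult.commute)
    qed
  qed (auto simp: dist_commute)
  then show ?thesis by (simp add: z dist_norm)
qed

text \<open>A Taylor estimate by induction: each integration from \<open>z\<close> gains one order
  of vanishing at the price of one more derivative, hence the generalization over
  \<open>bs\<close>.\<close>

lemma flat_bound:
  assumes "bs \<in> lists Basis"
  shows "\<exists>p. schwartz_dominated p \<and>
    (\<forall>(s::'a::euclidean_space \<Rightarrow> real) x z. s \<in> schwartz_space \<longrightarrow> (\<forall>bs\<in>lists Basis. iter_pd bs s z = 0) \<longrightarrow>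
       \<bar>iter_pd bs s x\<bar> \<le> p s * dist x z ^ N)"
  using assms
proof (induction N arbitrary: bs)
  case 0
  show ?case
    using schwartz_seminorm_upper[OF _ 0, of _ _ 0]
    by (intro exI[of _ "schwartz_seminorm 0 bs"] conjI schwartz_dominated_seminorm[OF 0]) auto
next
  case (Suc N)
  have "\<exists>p. schwartz_dominated p \<and>
    (\<forall>(s::'a \<Rightarrow> real) x z. s \<in> schwartz_space \<longrightarrow> (\<forall>bs\<in>lists Basis. iter_pd bs s z = 0) \<longrightarrow>
       \<bar>iter_pd (b # bs) s x\<bar> \<le> p s * dist x z ^ N)" if "b \<in> Basis" for b
    by (rule Suc.IH) (use Suc.prems that in auto)
  then obtain p where p: "\<And>b. b \<in> Basis \<Longrightarrow> schwartz_dominated (p b)"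
    "\<And>b (s::'a \<Rightarrow> real) x z. b \<in> Basis \<Longrightarrow> s \<in> schwartz_space \<Longrightarrow> (\<forall>bs\<in>lists Basis. iter_pd bs s z = 0) \<Longrightarrow>
       \<bar>iter_pd (b # bs) s x\<bar> \<le> p b s * dist x z ^ N"
    by metis
  show ?case
  proof (intro exI conjI allI impI)
    show "schwartz_dominated (\<lambda>s. \<Sum>b\<in>Basis. p b s)"
      using p(1) by (intro schwartz_dominated_sum) auto
    fix s :: "'a \<Rightarrow> real" and x z :: 'a
    assume s: "s \<in> schwartz_space" and z: "\<forall>bs\<in>lists Basis. iter_pd bs s z = 0"
    have "\<bar>iter_pd bs s x\<bar> \<le> (\<Sum>b\<in>Basis. p b s * dist x z ^ N) * dist x z"
    proof (rule flat_increment[OF s Suc.prems])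
      show "iter_pd bs s z = 0" using z Suc.prems by blast
      fix b y :: 'a assume b: "b \<in> Basis" and y: "dist y z \<le> dist x z"
      have "\<bar>iter_pd (b # bs) s y\<bar> \<le> p b s * dist y z ^ N"
        by (rule p(2)[OF b s z])
      also have "\<dots> \<le> p b s * dist x z ^ N"
        using y schwartz_dominated_nonneg[OF p(1)[OF b] s] by (intro mult_left_mono power_mono) auto
      finally show "\<bar>iter_pd (b # bs) s y\<bar> \<le> p b s * dist x z ^ N" .
    qed
    then show "\<bar>iter_pd bs s x\<bar> \<le> (\<Sum>b\<in>Basis. p b s) * dist x z ^ Suc N"
      by (simp add: sum_distrib_right[symmetric] mult_ac)
  qed
qed

text \<open>The weight is gained by interpolation: the square of the left-hand side is bounded by the
  product of a pure decay estimate and a pure flatness estimate.\<close>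

lemma flat_decay_bound:
  assumes bs: "bs \<in> lists (Basis :: 'a::euclidean_space set)"
  shows "\<exists>p. schwartz_dominated p \<and>
    (\<forall>(s::'a::euclidean_space \<Rightarrow> real) x z. s \<in> schwartz_space \<longrightarrow> (\<forall>bs\<in>lists Basis. iter_pd bs s z = 0) \<longrightarrow>
       norm x ^ k * \<bar>iter_pd bs s x\<bar> \<le> p s * dist x z ^ N)"
proof -
  obtain p where p: "schwartz_dominated p"
    "\<And>(s::'a \<Rightarrow> real) x z. s \<in> schwartz_space \<Longrightarrow> (\<forall>bs\<in>lists Basis. iter_pd bs s z = 0) \<Longrightarrow>
       \<bar>iter_pd bs s x\<bar> \<le> p s * dist x z ^ (2 * N)"
    using flat_bound[OF bs, of "2 * N"] by auto
  let ?q = "schwartz_seminorm (2 * k) bs"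
  show ?thesis
  proof (intro exI conjI allI impI)
    show "schwartz_dominated (\<lambda>s. p s + ?q s)"
      by (intro schwartz_dominated_add p(1) schwartz_dominated_seminorm bs)
    fix s :: "'a \<Rightarrow> real" and x z :: 'a
    assume s: "s \<in> schwartz_space" and z: "\<forall>bs\<in>lists Basis. iter_pd bs s z = 0"
    have p0: "0 \<le> p s" and q0: "0 \<le> ?q s"
      using schwartz_dominated_nonneg[OF p(1) s] schwartz_seminorm_nonneg[OF s bs] by auto
    have "(norm x ^ k * \<bar>iter_pd bs s x\<bar>)\<^sup>2 = (norm x ^ (2 * k) * \<bar>iter_pd bs s x\<bar>) * \<bar>iter_pd bs s x\<bar>"
      by (simp add: power2_eq_square power_mult mult_ac)
    also have "\<dots> \<le> ?q s * (p s * dist x z ^ (2 * N))"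
      by (intro mult_mono schwartz_seminorm_upper p(2) s z bs) (use q0 in auto)
    also have "\<dots> \<le> (p s + ?q s)\<^sup>2 * (dist x z ^ N)\<^sup>2"
    proof -
      have "?q s * p s \<le> (p s + ?q s) * (p s + ?q s)"
        using p0 q0 by (intro mult_mono) auto
      then have "(?q s * p s) * (dist x z ^ N)\<^sup>2 \<le> (p s + ?q s)\<^sup>2 * (dist x z ^ N)\<^sup>2"
        by (intro mult_right_mono) (auto simp: power2_eq_square)
      then show ?thesis by (simp add: power_mult[symmetric] mult_ac)
    qed
    finally have "(norm x ^ k * \<bar>iter_pd bs s x\<bar>)\<^sup>2 \<le> ((p s + ?q s) * dist x z ^ N)\<^sup>2"
      by (simp add: power_mult_distrib)
    then show "norm x ^ k * \<bar>iter_pd bs s x\<bar> \<le> (p s + ?q s) * dist x z ^ N"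
      by (rule power2_le_imp_le) (use p0 q0 in auto)
  qed
qed

text \<open>The cut at 1 makes the reciprocal at least 1, so that its powers increase with the
  exponent, and it separates flatness near the boundary from decay far away. Since
  \<open>infdist\<close> to the empty set is 0, \<open>U \<noteq> UNIV\<close> appears as a
  hypothesis below.\<close>

definition bdist :: "'a::metric_space set \<Rightarrow> 'a \<Rightarrow> real" where
  "bdist U x = min 1 (infdist x (- U))"

lemma bdist_nonneg: "0 \<le> bdist U x" and bdist_le_1: "bdist U x \<le> 1"
  by (auto simp: bdist_def infdist_nonneg)

lemma bdist_pos:
  assumes "open U" "U \<noteq> UNIV" "x \<in> U"
  shows "0 < bdist U x"
proof -
  have "infdist x (- U) \<noteq> 0"
    using in_closed_iff_infdist_zero[of "- U" x] assms by (auto simp: closed_Compl)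
  then show ?thesis
    using infdist_nonneg[of x "- U"] by (simp add: bdist_def)
qed

lemma bdist_le_dist: "z \<notin> U \<Longrightarrow> bdist U x \<le> dist x z"
  unfolding bdist_def using infdist_le[of z "- U" x] by auto

lemma ball_bdist_subset: "ball x (bdist U x) \<subseteq> U"
proof
  fix y assume "y \<in> ball x (bdist U x)"
  then show "y \<in> U"
    using bdist_le_dist[of y U x] by auto
qed

text \<open>Flatness is used at a nearest point \<open>z\<close> of the complement. Exponent 0
  covers the points at distance more than 1, where \<open>bdist\<close> equals 1, and exponent
  \<open>N\<close> the others.\<close>

lemma flat_bdist_bound:
  assumes bs: "bs \<in> lists (Basis :: 'a::euclidean_space set)" and V: "open V" "V \<noteq> UNIV"
  shows "\<exists>p. schwartz_dominated p \<and>
    (\<forall>s\<in>schwartz_space_on V. \<forall>x.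
       (1 + norm x) ^ k * \<bar>iter_pd bs s x\<bar> \<le> p s * bdist V x ^ N)"
proof -
  have "\<exists>p. schwartz_dominated p \<and>
    (\<forall>(s::'a \<Rightarrow> real) x z. s \<in> schwartz_space \<longrightarrow> (\<forall>bs\<in>lists Basis. iter_pd bs s z = 0) \<longrightarrow>
       (1 + norm x) ^ k * \<bar>iter_pd bs s x\<bar> \<le> p s * dist x z ^ N)" for N
  proof -
    obtain p where p: "schwartz_dominated p"
      "\<And>(s::'a \<Rightarrow> real) x z. s \<in> schwartz_space \<Longrightarrow> (\<forall>bs\<in>lists Basis. iter_pd bs s z = 0) \<Longrightarrow>
         norm x ^ 0 * \<bar>iter_pd bs s x\<bar> \<le> p s * dist x z ^ N"
      using flat_decay_bound[OF bs, of 0 N] by auto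
    obtain q where q: "schwartz_dominated q"
      "\<And>(s::'a \<Rightarrow> real) x z. s \<in> schwartz_space \<Longrightarrow> (\<forall>bs\<in>lists Basis. iter_pd bs s z = 0) \<Longrightarrow>
         norm x ^ k * \<bar>iter_pd bs s x\<bar> \<le> q s * dist x z ^ N"
      using flat_decay_bound[OF bs, of k N] by auto
    show ?thesis
    proof (intro exI conjI allI impI)
      show "schwartz_dominated (\<lambda>s. 2 ^ k * (p s + q s))"
        by (intro schwartz_dominated_scale schwartz_dominated_add p q) auto
      fix s :: "'a \<Rightarrow> real" and x z :: 'a
      assume s: "s \<in> schwartz_space" and z: "\<forall>bs\<in>lists Basis. iter_pd bs s z = 0"
      have "(1 + norm x) ^ k \<le> (2 * max 1 (norm x)) ^ k"
        by (intro power_mono) auto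
      also have "\<dots> \<le> 2 ^ k * (norm x ^ 0 + norm x ^ k)"
        unfolding power_mult_distrib by (intro mult_left_mono) (auto simp: max_def)
      finally have "(1 + norm x) ^ k * \<bar>iter_pd bs s x\<bar> \<le> 2 ^ k * (norm x ^ 0 + norm x ^ k) * \<bar>iter_pd bs s x\<bar>"
        by (intro mult_right_mono) auto
      also have "\<dots> = 2 ^ k * (norm x ^ 0 * \<bar>iter_pd bs s x\<bar> + norm x ^ k * \<bar>iter_pd bs s x\<bar>)"
        by (simp add: algebra_simps)
      also have "\<dots> \<le> 2 ^ k * (p s * dist x z ^ N + q s * dist x z ^ N)"
        by (intro mult_left_mono add_mono p q s z) auto
      finally show "(1 + norm x) ^ k * \<bar>iter_pd bs s x\<bar> \<le> 2 ^ k * (p s + q s) * dist x z ^ N"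
        by (simp add: algebra_simps)
    qed
  qed
  note * = this
  obtain p where p: "schwartz_dominated p"
    "\<And>(s::'a \<Rightarrow> real) x z. s \<in> schwartz_space \<Longrightarrow> (\<forall>bs\<in>lists Basis. iter_pd bs s z = 0) \<Longrightarrow>
         (1 + norm x) ^ k * \<bar>iter_pd bs s x\<bar> \<le> p s * dist x z ^ 0"
    using *[of 0] by auto
  obtain q where q: "schwartz_dominated q"
    "\<And>(s::'a \<Rightarrow> real) x z. s \<in> schwartz_space \<Longrightarrow> (\<forall>bs\<in>lists Basis. iter_pd bs s z = 0) \<Longrightarrow>
         (1 + norm x) ^ k * \<bar>iter_pd bs s x\<bar> \<le> q s * dist x z ^ N"
    using *[of N] by auto
  show ?thesis
  proof (intro exI conjI ballI allI)
    show "schwartz_dominated (\<lambda>s. p s + q s)"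
      by (intro schwartz_dominated_add p q)
    fix s :: "'a \<Rightarrow> real" and x :: 'a
    assume sV: "s \<in> schwartz_space_on V"
    then have s: "s \<in> schwartz_space" by (rule schwartz_on_imp_schwartz)
    have nn: "0 \<le> p s" "0 \<le> q s"
      using schwartz_dominated_nonneg p(1) q(1) s by auto
    obtain z where z: "z \<in> - V" "infdist x (- V) = dist x z"
      using infdist_attains_inf[of "- V" x] V by (auto simp: closed_Compl)
    have flat: "\<forall>bs\<in>lists Basis. iter_pd bs s z = 0"
      using sV z by (auto simp: schwartz_space_on_def)
    show "(1 + norm x) ^ k * \<bar>iter_pd bs s x\<bar> \<le> (p s + q s) * bdist V x ^ N"
    proof (cases "dist x z \<le> 1")
      case True
      then have "bdist V x = dist x z" by (simp add: bdist_def z)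
      moreover have "q s * dist x z ^ N \<le> (p s + q s) * dist x z ^ N"
        using nn by (intro mult_right_mono) auto
      ultimately show ?thesis using q(2)[OF s flat, of x] by simp
    next
      case False
      then have "bdist V x = 1" by (simp add: bdist_def z)
      then show ?thesis using p(2)[OF s flat, of x] nn by simp
    qed
  qed
qed

section \<open>Composition with a holomorphic map\<close>

text \<open>Polynomials in the real and imaginary parts of the derivatives of \<phi>; the factor
  \<open>c\<close> inside \<open>Re\<close> selects the part. Closure under directional derivatives
  replaces an explicit higher chain rule.\<close>

inductive derivative_polynomial :: "(complex \<Rightarrow> complex) \<Rightarrow> (complex \<Rightarrow> real) \<Rightarrow> bool" for \<phi> where
  const: "derivative_polynomial \<phi> (\<lambda>z. c)"
| deriv: "derivative_polynomial \<phi> (\<lambda>z. Re (c * (deriv ^^ n) \<phi> z))"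
| add: "derivative_polynomial \<phi> P \<Longrightarrow> derivative_polynomial \<phi> Q \<Longrightarrow> derivative_polynomial \<phi> (\<lambda>z. P z + Q z)"
| mult: "derivative_polynomial \<phi> P \<Longrightarrow> derivative_polynomial \<phi> Q \<Longrightarrow> derivative_polynomial \<phi> (\<lambda>z. P z * Q z)"

text \<open>The elements are operators acting on \<open>s\<close> and not single functions: the
  coefficients \<open>P\<close> are fixed before \<open>s\<close>, which makes the later bounds
  uniform in \<open>s\<close>.\<close>

inductive composite_operator ::
  "(complex \<Rightarrow> complex) \<Rightarrow> ((complex \<Rightarrow> real) \<Rightarrow> complex \<Rightarrow> real) \<Rightarrow> bool" for \<phi> where
  summand: "bs \<in> lists Basis \<Longrightarrow> derivative_polynomial \<phi> P \<Longrightarrow>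
    composite_operator \<phi> (\<lambda>s z. iter_pd bs s (\<phi> z) * P z)"
| add: "composite_operator \<phi> F \<Longrightarrow> composite_operator \<phi> G \<Longrightarrow> composite_operator \<phi> (\<lambda>s z. F s z + G s z)"

lemma holomorphic_iter_deriv_has_derivative:
  assumes "\<phi> holomorphic_on U" "open U" "z \<in> U"
  shows "((deriv ^^ n) \<phi> has_derivative (\<lambda>h. h * (deriv ^^ Suc n) \<phi> z)) (at z)"
proof -
  have "(deriv ^^ n) \<phi> holomorphic_on U"
    using assms by (intro holomorphic_higher_deriv) auto
  then have "((deriv ^^ n) \<phi> has_field_derivative deriv ((deriv ^^ n) \<phi>) z) (at z)"
    using assms by (intro holomorphic_derivI[where S=U]) auto
  then show ?thesis
    by (simp add: has_field_derivative_def mult_commute_abs)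
qed

lemma derivative_polynomial_has_derivative:
  assumes "derivative_polynomial \<phi> P" and \<phi>: "\<phi> holomorphic_on U" "open U"
  shows "\<exists>D. (\<forall>h. derivative_polynomial \<phi> (D h)) \<and> (\<forall>z\<in>U. (P has_derivative (\<lambda>h. D h z)) (at z))"
  using assms(1)
proof induction
  case (const c)
  show ?case
    by (intro exI[of _ "\<lambda>h z. 0"]) (auto intro: derivative_polynomial.const)
next
  case (deriv c n)
  show ?case
  proof (intro exI[of _ "\<lambda>h z. Re (c * h * (deriv ^^ Suc n) \<phi> z)"] conjI allI ballI)
    fix z assume "z \<in> U"
    have "((\<lambda>z. Re (c * (deriv ^^ n) \<phi> z)) has_derivative (\<lambda>h. Re (c * (h * (deriv ^^ Suc n) \<phi> z)))) (at z)"
      by (intro has_derivative_Re has_derivative_mult_right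
          holomorphic_iter_deriv_has_derivative[OF \<phi> \<open>z \<in> U\<close>])
    then show "((\<lambda>z. Re (c * (deriv ^^ n) \<phi> z)) has_derivative (\<lambda>h. Re (c * h * (deriv ^^ Suc n) \<phi> z))) (at z)"
      by (simp only: mult.assoc)
  qed (rule derivative_polynomial.deriv)
next
  case (add P Q)
  obtain D where D: "\<And>h. derivative_polynomial \<phi> (D h)" "\<And>z. z \<in> U \<Longrightarrow> (P has_derivative (\<lambda>h. D h z)) (at z)"
    using add.IH(1) by auto
  obtain E where E: "\<And>h. derivative_polynomial \<phi> (E h)" "\<And>z. z \<in> U \<Longrightarrow> (Q has_derivative (\<lambda>h. E h z)) (at z)"
    using add.IH(2) by auto
  show ?case
    by (intro exI[of _ "\<lambda>h z. D h z + E h z"] conjI allI ballI derivative_polynomial.add D E has_derivative_add)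
next
  case (mult P Q)
  obtain D where D: "\<And>h. derivative_polynomial \<phi> (D h)" "\<And>z. z \<in> U \<Longrightarrow> (P has_derivative (\<lambda>h. D h z)) (at z)"
    using mult.IH(1) by auto
  obtain E where E: "\<And>h. derivative_polynomial \<phi> (E h)" "\<And>z. z \<in> U \<Longrightarrow> (Q has_derivative (\<lambda>h. E h z)) (at z)"
    using mult.IH(2) by auto
  show ?case
    by (intro exI[of _ "\<lambda>h z. P z * E h z + D h z * Q z"] conjI allI ballI derivative_polynomial.add
        derivative_polynomial.mult mult.hyps D E has_derivative_mult)
qed

lemma smooth_comp_has_derivative:
  fixes s :: "complex \<Rightarrow> real"
  assumes s: "smooth_on UNIV s" and bs: "bs \<in> lists Basis"
    and \<phi>: "\<phi> holomorphic_on U" "open U" "z \<in> U"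
  shows "((\<lambda>z. iter_pd bs s (\<phi> z)) has_derivative
    (\<lambda>h. iter_pd (1 # bs) s (\<phi> z) * Re (h * deriv \<phi> z) + iter_pd (\<i> # bs) s (\<phi> z) * Re (- \<i> * h * deriv \<phi> z))) (at z)"
proof -
  have "(\<phi> has_derivative (\<lambda>h. h * deriv \<phi> z)) (at z)"
    using holomorphic_iter_deriv_has_derivative[OF \<phi>, of 0] by simp
  from has_derivative_compose[OF this iter_pd_has_derivative[OF s bs UNIV_I]]
  have "((\<lambda>z. iter_pd bs s (\<phi> z)) has_derivative
      (\<lambda>h. frechet_derivative (iter_pd bs s) (at (\<phi> z)) (h * deriv \<phi> z))) (at z)" .
  moreover have "frechet_derivative (iter_pd bs s) (at (\<phi> z)) w
      = iter_pd (1 # bs) s (\<phi> z) * Re w + iter_pd (\<i> # bs) s (\<phi> z) * Re (- \<i> * w)" for w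
    by (subst frechet_derivative_eq_sum_iter_pd[OF s bs UNIV_I]) (simp add: Basis_complex_def)
  ultimately show ?thesis
    by (simp only: mult.assoc)
qed

lemma composite_operator_has_derivative:
  assumes "composite_operator \<phi> F" and \<phi>: "\<phi> holomorphic_on U" "open U"
  shows "\<exists>G. (\<forall>h. composite_operator \<phi> (G h)) \<and>
    (\<forall>s. smooth_on UNIV s \<longrightarrow> (\<forall>z\<in>U. (F s has_derivative (\<lambda>h. G h s z)) (at z)))"
  using assms(1)
proof induction
  case (summand bs P)
  obtain D where D: "\<And>h. derivative_polynomial \<phi> (D h)" "\<And>z. z \<in> U \<Longrightarrow> (P has_derivative (\<lambda>h. D h z)) (at z)"
    using derivative_polynomial_has_derivative[OF summand(2) \<phi>] by auto
  define G where "G = (\<lambda>h s z. iter_pd bs s (\<phi> z) * D h z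
    + (iter_pd (1 # bs) s (\<phi> z) * (Re (h * (deriv ^^ 1) \<phi> z) * P z)
    + iter_pd (\<i> # bs) s (\<phi> z) * (Re (- \<i> * h * (deriv ^^ 1) \<phi> z) * P z)))"
  show ?case
  proof (intro exI[of _ G] conjI allI impI ballI)
    show "composite_operator \<phi> (G h)" for h
      unfolding G_def using summand
      by (intro composite_operator.intros derivative_polynomial.mult derivative_polynomial.deriv D)
        (auto simp: Basis_complex_def)
    fix s :: "complex \<Rightarrow> real" and z assume s: "smooth_on UNIV s" and z: "z \<in> U"
    show "((\<lambda>z. iter_pd bs s (\<phi> z) * P z) has_derivative (\<lambda>h. G h s z)) (at z)"
      using has_derivative_mult[OF smooth_comp_has_derivative[OF s summand(1) \<phi> z] D(2)[OF z]]
      by (simp add: G_def algebra_simps)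
  qed
next
  case (add F1 F2)
  obtain G1 where G1: "\<And>h. composite_operator \<phi> (G1 h)"
     "\<And>s z. smooth_on UNIV s \<Longrightarrow> z \<in> U \<Longrightarrow> (F1 s has_derivative (\<lambda>h. G1 h s z)) (at z)"
    using add.IH(1) by auto
  obtain G2 where G2: "\<And>h. composite_operator \<phi> (G2 h)"
     "\<And>s z. smooth_on UNIV s \<Longrightarrow> z \<in> U \<Longrightarrow> (F2 s has_derivative (\<lambda>h. G2 h s z)) (at z)"
    using add.IH(2) by auto
  show ?case
    by (intro exI[of _ "\<lambda>h s z. G1 h s z + G2 h s z"] conjI allI impI ballI composite_operator.add G1 G2 has_derivative_add)
qed

text \<open>The quantifier order is the point: one operator \<open>F\<close> serves all
  \<open>s\<close>. It arises by differentiating the operator for \<open>bs\<close> in the direction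
  \<open>b\<close>, and agreement on the open set \<open>U\<close> carries over to
  derivatives.\<close>

lemma iter_pd_comp_eq_composite_operator:
  assumes \<phi>: "\<phi> holomorphic_on U" "open U" and bs: "bs \<in> lists Basis"
  shows "\<exists>F. composite_operator \<phi> F \<and>
    (\<forall>s. smooth_on UNIV s \<longrightarrow> (\<forall>z\<in>U. iter_pd bs (\<lambda>z. s (\<phi> z)) z = F s z))"
  using bs
proof (induction bs)
  case Nil
  show ?case
    using composite_operator.summand[OF lists.Nil derivative_polynomial.const[of \<phi> 1]]
    by (intro exI[of _ "\<lambda>s z. iter_pd [] s (\<phi> z) * 1"]) auto
next
  case (Cons b bs)
  obtain F where F: "composite_operator \<phi> F"
    "\<And>s z. smooth_on UNIV s \<Longrightarrow> z \<in> U \<Longrightarrow> iter_pd bs (\<lambda>z. s (\<phi> z)) z = F s z"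
    using Cons.IH by auto
  obtain G where G: "\<And>h. composite_operator \<phi> (G h)"
    "\<And>s z. smooth_on UNIV s \<Longrightarrow> z \<in> U \<Longrightarrow> (F s has_derivative (\<lambda>h. G h s z)) (at z)"
    using composite_operator_has_derivative[OF F(1) \<phi>] by auto
  show ?case
  proof (intro exI[of _ "G b"] conjI allI impI ballI G)
    fix s :: "complex \<Rightarrow> real" and z assume s: "smooth_on UNIV s" and z: "z \<in> U"
    have "frechet_derivative (iter_pd bs (\<lambda>z. s (\<phi> z))) (at z) = frechet_derivative (F s) (at z)"
      by (rule frechet_derivative_cong_open[OF \<phi>(2) z]) (rule F(2)[OF s])
    also have "\<dots> = (\<lambda>h. G h s z)"
      using frechet_derivative_at[OF G(2)[OF s z]] by simp
    finally show "iter_pd (b # bs) (\<lambda>z. s (\<phi> z)) z = G b s z" by simp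
  qed
qed

section \<open>Smoothness of compositions and of holomorphic maps\<close>

lemma smooth_on_comp_holomorphic:
  fixes s :: "complex \<Rightarrow> real"
  assumes \<phi>: "\<phi> holomorphic_on U" "open U" and s: "smooth_on UNIV s"
  shows "smooth_on U (\<lambda>z. s (\<phi> z))"
  unfolding smooth_on_def
proof (intro ballI)
  fix bs :: "complex list" and z assume bs: "bs \<in> lists Basis" and z: "z \<in> U"
  obtain F where F: "composite_operator \<phi> F"
    "\<And>s z. smooth_on UNIV s \<Longrightarrow> z \<in> U \<Longrightarrow> iter_pd bs (\<lambda>z. s (\<phi> z)) z = F s z"
    using iter_pd_comp_eq_composite_operator[OF \<phi> bs] by auto
  obtain G where G: "\<And>h. composite_operator \<phi> (G h)"
    "\<And>s z. smooth_on UNIV s \<Longrightarrow> z \<in> U \<Longrightarrow> (F s has_derivative (\<lambda>h. G h s z)) (at z)"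
    using composite_operator_has_derivative[OF F(1) \<phi>] by auto
  have "F s differentiable (at z)"
    using G(2)[OF s z] by (rule differentiableI)
  then show "iter_pd bs (\<lambda>z. s (\<phi> z)) differentiable (at z)"
    using differentiable_cong_open[OF \<phi>(2) z F(2)[OF s]] by simp
qed

lemma iter_pd_holomorphic:
  assumes "\<phi> holomorphic_on U" "open U" "z \<in> U"
  shows "iter_pd bs \<phi> z = prod_list bs * (deriv ^^ length bs) \<phi> z"
  using assms(3)
proof (induction bs arbitrary: z)
  case (Cons b bs)
  have "frechet_derivative (iter_pd bs \<phi>) (at z)
      = frechet_derivative (\<lambda>z. prod_list bs * (deriv ^^ length bs) \<phi> z) (at z)"
    by (rule frechet_derivative_cong_open[OF assms(2) Cons.prems Cons.IH])
  also have "\<dots> = (\<lambda>h. prod_list bs * (h * (deriv ^^ Suc (length bs)) \<phi> z))"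
    by (rule frechet_derivative_at[symmetric], rule has_derivative_mult_right,
        rule holomorphic_iter_deriv_has_derivative[OF assms(1,2) Cons.prems])
  finally show ?case by (simp add: mult_ac)
qed simp

lemma smooth_on_holomorphic:
  assumes \<phi>: "\<phi> holomorphic_on U" "open U"
  shows "smooth_on U \<phi>"
  unfolding smooth_on_def
proof (intro ballI)
  fix bs :: "complex list" and z assume z: "z \<in> U"
  have "(\<lambda>z. prod_list bs * (deriv ^^ length bs) \<phi> z) differentiable (at z)"
    by (rule differentiableI, rule has_derivative_mult_right,
        rule holomorphic_iter_deriv_has_derivative[OF \<phi> z])
  then show "iter_pd bs \<phi> differentiable (at z)"
    using differentiable_cong_open[OF \<phi>(2) z iter_pd_holomorphic[OF \<phi>]] by simp
qed

text \<open>The last assumption says that \<open>\<phi>\<close> is Hoelder continuous up to the boundary, with exponent \<open>1/N\<close>.\<close>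

locale tame_holomorphic_map =
  fixes U V :: "complex set" and \<phi> :: "complex \<Rightarrow> complex" and C :: real and N :: nat
  assumes U: "open U" "U \<noteq> UNIV" and V: "open V" "V \<noteq> UNIV"
    and holo: "\<phi> holomorphic_on U"
    and maps: "\<And>z. z \<in> U \<Longrightarrow> \<phi> z \<in> V"
    and C: "1 \<le> C"
    and growth: "\<And>z. z \<in> U \<Longrightarrow> norm (\<phi> z) \<le> C * (1 + norm z)"
    and cogrowth: "\<And>z. z \<in> U \<Longrightarrow> norm z \<le> C * (1 + norm (\<phi> z))"
    and boundary: "\<And>z. z \<in> U \<Longrightarrow> bdist V (\<phi> z) ^ N \<le> C * bdist U z"
begin

text \<open>Cauchy's inequality on a circle of half the distance, where \<phi> grows at most
  linearly. The exponent \<open>Suc n\<close> is generous, but it leaves a single base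
  \<open>(1 + norm z) / bdist U z\<close>, at least 1, in whose powers all estimates are
  expressed.\<close>

lemma iter_deriv_bound:
  assumes z: "z \<in> U"
  shows "norm ((deriv ^^ n) \<phi> z) \<le> fact n * 2 ^ Suc n * C * ((1 + norm z) / bdist U z) ^ Suc n"
proof -
  let ?d = "bdist U z"
  have d: "0 < ?d" "?d \<le> 1" using bdist_pos[OF U z] bdist_le_1 by auto
  have sub: "cball z (?d / 2) \<subseteq> U"
    using ball_bdist_subset[of z U] d by (auto simp: subset_iff)
  have "norm ((deriv ^^ n) \<phi> z) \<le> fact n * (2 * C * (1 + norm z)) / (?d / 2) ^ n"
  proof (rule Cauchy_inequality)
    show "\<phi> holomorphic_on ball z (?d / 2)"
      using holo by (rule holomorphic_on_subset) (use sub in auto)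
    show "continuous_on (cball z (?d / 2)) \<phi>"
      using holomorphic_on_imp_continuous_on[OF holo] sub by (rule continuous_on_subset)
    fix x assume x: "norm (z - x) = ?d / 2"
    then have "x \<in> U" using sub by (auto simp: dist_norm)
    have "norm x \<le> norm z + norm (z - x)"
      using norm_triangle_ineq4[of z "z - x"] by simp
    moreover have "norm (z - x) \<le> 1" using x d by simp
    moreover have "0 \<le> norm z" by simp
    ultimately have "1 + norm x \<le> 2 * (1 + norm z)" unfolding distrib_left by linarith
    then have "C * (1 + norm x) \<le> C * (2 * (1 + norm z))"
      using C by (intro mult_left_mono) auto
    then show "norm (\<phi> x) \<le> 2 * C * (1 + norm z)"
      using growth[OF \<open>x \<in> U\<close>] by (simp add: algebra_simps)
  qed (use d in auto)
  also have "\<dots> = fact n * 2 ^ Suc n * C * ((1 + norm z) * (1 / ?d) ^ n)"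
    using d by (simp add: field_simps)
  also have "\<dots> \<le> fact n * 2 ^ Suc n * C * ((1 + norm z) / ?d * ((1 + norm z) / ?d) ^ n)"
  proof -
    have "1 + norm z \<le> (1 + norm z) / ?d"
      using d mult_left_le[of ?d "1 + norm z"] by (simp add: le_divide_eq)
    moreover have "1 / ?d \<le> (1 + norm z) / ?d"
      using d by (intro divide_right_mono) auto
    ultimately show ?thesis
      using d C by (intro mult_left_mono mult_mono power_mono) auto
  qed
  finally show ?thesis by simp
qed

lemma derivative_polynomial_bound:
  assumes "derivative_polynomial \<phi> P"
  shows "\<exists>A\<ge>0. \<exists>m. \<forall>z\<in>U. \<bar>P z\<bar> \<le> A * ((1 + norm z) / bdist U z) ^ m"
  using assms
proof induction
  case (const c)
  show ?case by (rule exI[of _ "\<bar>c\<bar>"], simp, rule exI[of _ 0], simp)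
next
  case (deriv c n)
  show ?case
  proof (intro exI conjI ballI)
    show "0 \<le> norm c * (fact n * 2 ^ Suc n * C)" using C by simp
    fix z assume z: "z \<in> U"
    have "\<bar>Re (c * (deriv ^^ n) \<phi> z)\<bar> \<le> norm c * norm ((deriv ^^ n) \<phi> z)"
      using abs_Re_le_cmod[of "c * (deriv ^^ n) \<phi> z"] by (simp add: norm_mult)
    also have "\<dots> \<le> norm c * (fact n * 2 ^ Suc n * C * ((1 + norm z) / bdist U z) ^ Suc n)"
      by (intro mult_left_mono iter_deriv_bound z) auto
    finally show "\<bar>Re (c * (deriv ^^ n) \<phi> z)\<bar> \<le> norm c * (fact n * 2 ^ Suc n * C) * ((1 + norm z) / bdist U z) ^ Suc n"
      by (simp only: mult.assoc)
  qed
next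
  case (add P Q)
  obtain A m where A: "0 \<le> A" "\<And>z. z \<in> U \<Longrightarrow> \<bar>P z\<bar> \<le> A * ((1 + norm z) / bdist U z) ^ m"
    using add.IH(1) by auto
  obtain B n where B: "0 \<le> B" "\<And>z. z \<in> U \<Longrightarrow> \<bar>Q z\<bar> \<le> B * ((1 + norm z) / bdist U z) ^ n"
    using add.IH(2) by auto
  show ?case
  proof (intro exI conjI ballI)
    show "0 \<le> A + B" using A B by simp
    fix z assume z: "z \<in> U"
    \<comment> \<open>As the base is at least 1, both powers may be raised to the exponent
      \<open>m + n\<close>.\<close>
    have r: "1 \<le> (1 + norm z) / bdist U z"
      using bdist_pos[OF U z] bdist_le_1[of U z] by (simp add: field_simps add_increasing2)
    have "\<bar>P z + Q z\<bar> \<le> A * ((1 + norm z) / bdist U z) ^ m + B * ((1 + norm z) / bdist U z) ^ n"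
      using A(2)[OF z] B(2)[OF z] by linarith
    also have "\<dots> \<le> A * ((1 + norm z) / bdist U z) ^ (m + n) + B * ((1 + norm z) / bdist U z) ^ (m + n)"
      by (intro add_mono mult_left_mono power_increasing A B r) auto
    finally show "\<bar>P z + Q z\<bar> \<le> (A + B) * ((1 + norm z) / bdist U z) ^ (m + n)"
      by (simp only: distrib_right)
  qed
next
  case (mult P Q)
  obtain A m where A: "0 \<le> A" "\<And>z. z \<in> U \<Longrightarrow> \<bar>P z\<bar> \<le> A * ((1 + norm z) / bdist U z) ^ m"
    using mult.IH(1) by auto
  obtain B n where B: "0 \<le> B" "\<And>z. z \<in> U \<Longrightarrow> \<bar>Q z\<bar> \<le> B * ((1 + norm z) / bdist U z) ^ n"
    using mult.IH(2) by auto
  show ?case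
  proof (intro exI conjI ballI)
    show "0 \<le> A * B" using A B by simp
    fix z assume z: "z \<in> U"
    have "\<bar>P z * Q z\<bar> \<le> (A * ((1 + norm z) / bdist U z) ^ m) * (B * ((1 + norm z) / bdist U z) ^ n)"
      unfolding abs_mult using A B bdist_nonneg[of U z]
      by (intro mult_mono A(2) B(2) z) auto
    then show "\<bar>P z * Q z\<bar> \<le> (A * B) * ((1 + norm z) / bdist U z) ^ (m + n)"
      by (simp add: power_add mult_ac)
  qed
qed

text \<open>The negative powers of the distance to the boundary contributed by the derivatives of \<open>\<phi>\<close>
  are absorbed by the flatness of \<open>s\<close> at the boundary of \<open>V\<close>.\<close>

lemma composite_operator_bound:
  assumes "composite_operator \<phi> F"
  shows "\<exists>p. schwartz_dominated p \<and>
    (\<forall>s\<in>schwartz_space_on V. \<forall>z\<in>U. (1 + norm z) ^ k * \<bar>F s z\<bar> \<le> p s * bdist U z ^ M)"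
  using assms
proof induction
  case (summand bs P)
  obtain A m where A: "0 \<le> A" "\<And>z. z \<in> U \<Longrightarrow> \<bar>P z\<bar> \<le> A * ((1 + norm z) / bdist U z) ^ m"
    using derivative_polynomial_bound[OF summand(2)] by auto
  \<comment> \<open>Of the flatness order, \<open>N * m\<close> cancels the pole of \<open>P\<close>
    and \<open>N * M\<close> leaves \<open>bdist U z ^ M\<close>; the factor \<open>N\<close> is the
    loss in \<open>boundary\<close>. The extra weight \<open>m\<close> pays for the growth of
    \<open>P\<close> at infinity.\<close>
  obtain p where p: "schwartz_dominated p"
    "\<And>s x. s \<in> schwartz_space_on V \<Longrightarrow>
       (1 + norm x) ^ (m + k) * \<bar>iter_pd bs s x\<bar> \<le> p s * bdist V x ^ (N * (M + m))"
    using flat_bdist_bound[OF summand(1) V, of "m + k" "N * (M + m)"] by auto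
  define B where "B = A * (2 * C) ^ (m + k) * C ^ (M + m)"
  have "0 \<le> B" using A(1) C by (simp add: B_def)
  show ?case
  proof (intro exI conjI ballI)
    show "schwartz_dominated (\<lambda>s. B * p s)"
      by (rule schwartz_dominated_scale[OF p(1) \<open>0 \<le> B\<close>])
    fix s z assume s: "s \<in> schwartz_space_on V" and z: "z \<in> U"
    let ?w = "\<phi> z" and ?d = "bdist U z"
    have d: "0 < ?d" by (rule bdist_pos[OF U z])
    have p0: "0 \<le> p s"
      by (rule schwartz_dominated_nonneg[OF p(1) schwartz_on_imp_schwartz[OF s]])
    have "1 + norm z \<le> 2 * C * (1 + norm ?w)"
    proof -
      have "1 * 1 \<le> C * (1 + norm ?w)" using C by (intro mult_mono) auto
      then show ?thesis using cogrowth[OF z] by simp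
    qed
    then have w: "(1 + norm z) ^ (m + k) \<le> (2 * C) ^ (m + k) * (1 + norm ?w) ^ (m + k)"
      unfolding power_mult_distrib[symmetric] by (intro power_mono) auto
    have "(1 + norm z) ^ k * \<bar>iter_pd bs s ?w * P z\<bar>
        \<le> (1 + norm z) ^ k * (\<bar>iter_pd bs s ?w\<bar> * (A * ((1 + norm z) / ?d) ^ m))"
      unfolding abs_mult by (intro mult_left_mono A z) auto
    also have "\<dots> = A / ?d ^ m * \<bar>iter_pd bs s ?w\<bar> * (1 + norm z) ^ (m + k)"
      by (simp add: power_add power_divide)
    also have "\<dots> \<le> A / ?d ^ m * \<bar>iter_pd bs s ?w\<bar> * ((2 * C) ^ (m + k) * (1 + norm ?w) ^ (m + k))"
      using A d by (intro mult_left_mono w) auto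
    also have "\<dots> = A * (2 * C) ^ (m + k) / ?d ^ m * ((1 + norm ?w) ^ (m + k) * \<bar>iter_pd bs s ?w\<bar>)"
      by simp
    also have "\<dots> \<le> A * (2 * C) ^ (m + k) / ?d ^ m * (p s * bdist V ?w ^ (N * (M + m)))"
      using A C d by (intro mult_left_mono p(2) s) auto
    also have "\<dots> \<le> A * (2 * C) ^ (m + k) / ?d ^ m * (p s * (C * ?d) ^ (M + m))"
      unfolding power_mult using A C d p0
      by (intro mult_left_mono power_mono boundary z) (auto simp: bdist_nonneg)
    also have "\<dots> = B * p s * ?d ^ M"
      using d by (simp add: B_def power_mult_distrib power_add)
    finally show "(1 + norm z) ^ k * \<bar>iter_pd bs s ?w * P z\<bar> \<le> B * p s * ?d ^ M" .
  qed
next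
  case (add F G)
  obtain p where p: "schwartz_dominated p"
    "\<And>s z. s \<in> schwartz_space_on V \<Longrightarrow> z \<in> U \<Longrightarrow> (1 + norm z) ^ k * \<bar>F s z\<bar> \<le> p s * bdist U z ^ M"
    using add.IH(1) by auto
  obtain q where q: "schwartz_dominated q"
    "\<And>s z. s \<in> schwartz_space_on V \<Longrightarrow> z \<in> U \<Longrightarrow> (1 + norm z) ^ k * \<bar>G s z\<bar> \<le> q s * bdist U z ^ M"
    using add.IH(2) by auto
  show ?case
  proof (intro exI conjI ballI)
    show "schwartz_dominated (\<lambda>s. p s + q s)"
      by (intro schwartz_dominated_add p q)
    fix s z assume s: "s \<in> schwartz_space_on V" and z: "z \<in> U"
    have "(1 + norm z) ^ k * \<bar>F s z + G s z\<bar> \<le> (1 + norm z) ^ k * (\<bar>F s z\<bar> + \<bar>G s z\<bar>)"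
      by (intro mult_left_mono) auto
    also have "\<dots> \<le> p s * bdist U z ^ M + q s * bdist U z ^ M"
      unfolding distrib_left by (intro add_mono p q s z)
    finally show "(1 + norm z) ^ k * \<bar>F s z + G s z\<bar> \<le> (p s + q s) * bdist U z ^ M"
      by (simp only: distrib_right)
  qed
qed

lemma iter_pd_comp_bound:
  assumes bs: "bs \<in> lists Basis"
  shows "\<exists>p. schwartz_dominated p \<and>
    (\<forall>s\<in>schwartz_space_on V. \<forall>z\<in>U.
      (1 + norm z) ^ k * \<bar>iter_pd bs (\<lambda>z. s (\<phi> z)) z\<bar> \<le> p s * bdist U z ^ M)"
proof -
  obtain F where F: "composite_operator \<phi> F"
    "\<And>s z. smooth_on UNIV s \<Longrightarrow> z \<in> U \<Longrightarrow> iter_pd bs (\<lambda>z. s (\<phi> z)) z = F s z"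
    using iter_pd_comp_eq_composite_operator[OF holo U(1) bs] by auto
  obtain p where p: "schwartz_dominated p"
    "\<And>s z. s \<in> schwartz_space_on V \<Longrightarrow> z \<in> U \<Longrightarrow> (1 + norm z) ^ k * \<bar>F s z\<bar> \<le> p s * bdist U z ^ M"
    using composite_operator_bound[OF F(1), of k M] by auto
  show ?thesis
    by (intro exI[of _ p] conjI ballI p(1))
      (simp add: F(2) p(2) schwartz_smooth schwartz_on_imp_schwartz)
qed

section \<open>The pullback extended by zero\<close>

lemma iter_pd_pullback:
  assumes "z \<in> U"
  shows "iter_pd bs (pullback U \<phi> s) z = iter_pd bs (\<lambda>z. s (\<phi> z)) z"
  by (rule iter_pd_cong_open[OF U(1) assms]) (simp add: pullback_def)

text \<open>Value and derivative off \<open>U\<close> are treated together: the derivative at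
  \<open>z\<close> yields the value of the next iterated derivative, and the vanishing of that value
  enters the next difference quotient.\<close>

lemma pullback_flat:
  assumes s: "s \<in> schwartz_space_on V" and bs: "bs \<in> lists Basis" and z: "z \<notin> U"
  shows "iter_pd bs (pullback U \<phi> s) z = 0 \<and>
    (iter_pd bs (pullback U \<phi> s) has_derivative (\<lambda>h. 0)) (at z)"
  using bs z
proof (induction bs arbitrary: z)
  have D: "(iter_pd bs (pullback U \<phi> s) has_derivative (\<lambda>h. 0)) (at z)"
    if bs: "bs \<in> lists Basis" and 0: "\<And>z. z \<notin> U \<Longrightarrow> iter_pd bs (pullback U \<phi> s) z = 0" and z: "z \<notin> U"
    for bs z
  proof -
    \<comment> \<open>Vanishing of order 2 bounds the difference quotient by a multiple of
      \<open>norm (y - z)\<close>, so the derivative at \<open>z\<close> is 0.\<close>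
    obtain p where p: "schwartz_dominated p"
      "\<And>s z. s \<in> schwartz_space_on V \<Longrightarrow> z \<in> U \<Longrightarrow>
        (1 + norm z) ^ 0 * \<bar>iter_pd bs (\<lambda>z. s (\<phi> z)) z\<bar> \<le> p s * bdist U z ^ 2"
      using iter_pd_comp_bound[OF bs, of 0 2] by auto
    have p0: "0 \<le> p s"
      by (rule schwartz_dominated_nonneg[OF p(1) schwartz_on_imp_schwartz[OF s]])
    have bd: "\<bar>iter_pd bs (pullback U \<phi> s) y\<bar> \<le> p s * norm (y - z) ^ 2" for y
    proof (cases "y \<in> U")
      case True
      have "\<bar>iter_pd bs (pullback U \<phi> s) y\<bar> \<le> p s * bdist U y ^ 2"
        using p(2)[OF s True] by (simp add: iter_pd_pullback[OF True])
      also have "\<dots> \<le> p s * norm (y - z) ^ 2"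
        using bdist_le_dist[OF z, of y] p0 bdist_nonneg[of U y]
        by (intro mult_left_mono power_mono) (auto simp: dist_norm)
      finally show ?thesis .
    next
      case False
      then show ?thesis using 0 p0 by simp
    qed
    have "((\<lambda>y. norm (iter_pd bs (pullback U \<phi> s) y - iter_pd bs (pullback U \<phi> s) z - 0) / norm (y - z)) \<longlongrightarrow> 0) (at z)"
    proof (rule tendsto_sandwich[where f = "\<lambda>_. 0" and h = "\<lambda>y. p s * norm (y - z)"])
      show "\<forall>\<^sub>F y in at z. norm (iter_pd bs (pullback U \<phi> s) y - iter_pd bs (pullback U \<phi> s) z - 0) / norm (y - z)
          \<le> p s * norm (y - z)"
        using bd by (intro always_eventually allI) (auto simp: 0[OF z] divide_le_eq power2_eq_square mult_ac p0)
      have "((\<lambda>y. p s * norm (y - z)) \<longlongrightarrow> p s * norm (z - z)) (at z)"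
        by (intro tendsto_intros)
      then show "((\<lambda>y. p s * norm (y - z)) \<longlongrightarrow> 0) (at z)" by simp
    qed auto
    then show ?thesis
      by (simp add: has_derivative_iff_norm)
  qed
  {
    case Nil
    then show ?case using D[of "[]"] by (auto simp: pullback_def)
  next
    case (Cons b bs)
    have 0: "iter_pd (b # bs) (pullback U \<phi> s) z = 0" if "z \<notin> U" for z
      using frechet_derivative_at[of "iter_pd bs (pullback U \<phi> s)" "\<lambda>h. 0" z] Cons.IH[OF that] by (metis iter_pd.simps(2))
    then show ?case using D[of "b # bs" z] Cons by auto
  }
qed

lemma pullback_weighted_bound:
  assumes bs: "bs \<in> lists Basis"
  shows "\<exists>p. schwartz_dominated p \<and>
    (\<forall>s\<in>schwartz_space_on V. \<forall>z. norm z ^ k * \<bar>iter_pd bs (pullback U \<phi> s) z\<bar> \<le> p s)"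
proof -
  obtain p where p: "schwartz_dominated p"
    "\<And>s z. s \<in> schwartz_space_on V \<Longrightarrow> z \<in> U \<Longrightarrow>
      (1 + norm z) ^ k * \<bar>iter_pd bs (\<lambda>z. s (\<phi> z)) z\<bar> \<le> p s * bdist U z ^ 0"
    using iter_pd_comp_bound[OF bs, of k 0] by auto
  have "norm z ^ k * \<bar>iter_pd bs (pullback U \<phi> s) z\<bar> \<le> p s" if s: "s \<in> schwartz_space_on V" for s z
  proof (cases "z \<in> U")
    case True
    have "norm z ^ k * \<bar>iter_pd bs (pullback U \<phi> s) z\<bar> \<le> (1 + norm z) ^ k * \<bar>iter_pd bs (pullback U \<phi> s) z\<bar>"
      by (intro mult_right_mono power_mono) auto
    then show ?thesis using p(2)[OF s True] by (simp add: iter_pd_pullback[OF True])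
  next
    case False
    then show ?thesis
      using pullback_flat[OF s bs False] schwartz_dominated_nonneg[OF p(1) schwartz_on_imp_schwartz[OF s]]
      by simp
  qed
  with p(1) show ?thesis by auto
qed

lemma pullback_smooth:
  assumes s: "s \<in> schwartz_space_on V"
  shows "smooth_on UNIV (pullback U \<phi> s)"
  unfolding smooth_on_def
proof (intro ballI)
  fix bs :: "complex list" and z :: complex assume bs: "bs \<in> lists Basis"
  show "iter_pd bs (pullback U \<phi> s) differentiable (at z)"
  proof (cases "z \<in> U")
    case True
    have "smooth_on U (\<lambda>z. s (\<phi> z))"
      by (rule smooth_on_comp_holomorphic[OF holo U(1) schwartz_smooth[OF schwartz_on_imp_schwartz[OF s]]])
    then have "iter_pd bs (\<lambda>z. s (\<phi> z)) differentiable (at z)"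
      using bs True by (auto simp: smooth_on_def)
    then show ?thesis
      using differentiable_cong_open[OF U(1) True iter_pd_pullback] by simp
  next
    case False
    then show ?thesis
      using pullback_flat[OF s bs False] by (blast intro: differentiableI)
  qed
qed

lemma pullback_schwartz_on:
  assumes s: "s \<in> schwartz_space_on V"
  shows "pullback U \<phi> s \<in> schwartz_space_on U"
proof -
  have "bdd_above (range (\<lambda>z. norm z ^ k * \<bar>iter_pd bs (pullback U \<phi> s) z\<bar>))" if bs: "bs \<in> lists Basis" for k bs
  proof -
    obtain p where "\<And>z. norm z ^ k * \<bar>iter_pd bs (pullback U \<phi> s) z\<bar> \<le> p s"
      using pullback_weighted_bound[OF bs, of k] s by auto
    then show ?thesis by (rule bdd_aboveI2)
  qed
  then show ?thesis
    unfolding schwartz_space_on_def schwartz_space_def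
    using pullback_smooth[OF s] pullback_flat[OF s] by auto
qed

lemma continuous_map_pullback:
  "continuous_map (schwartz_topology_on V) (schwartz_topology_on U) (pullback U \<phi>)"
proof (rule continuous_map_schwartz)
  show "pullback U \<phi> s \<in> schwartz_space_on U" if "s \<in> schwartz_space_on V" for s
    by (rule pullback_schwartz_on[OF that])
  show "pullback U \<phi> (\<lambda>x. s x - t x) = (\<lambda>x. pullback U \<phi> s x - pullback U \<phi> t x)" for s t
    by (auto simp: pullback_def)
  fix k and bs :: "complex list" assume bs: "bs \<in> lists Basis"
  obtain p where p: "schwartz_dominated p"
    "\<And>s z. s \<in> schwartz_space_on V \<Longrightarrow> norm z ^ k * \<bar>iter_pd bs (pullback U \<phi> s) z\<bar> \<le> p s"
    using pullback_weighted_bound[OF bs, of k] by auto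
  show "\<exists>p. schwartz_dominated p \<and>
      (\<forall>s\<in>schwartz_space_on V. schwartz_seminorm k bs (pullback U \<phi> s) \<le> p s)"
    by (intro exI[of _ p] conjI ballI p(1) schwartz_seminorm_least p(2))
qed

end

theorem schwartz_equivalent_tame_holomorphic:
  assumes \<phi>: "tame_holomorphic_map U V \<phi> C N" and \<psi>: "tame_holomorphic_map V U \<psi> D M"
    and inv: "\<And>z. z \<in> U \<Longrightarrow> \<psi> (\<phi> z) = z" "\<And>w. w \<in> V \<Longrightarrow> \<phi> (\<psi> w) = w"
  shows "schwartz_equivalent U V"
proof -
  interpret f: tame_holomorphic_map U V \<phi> C N by fact
  interpret g: tame_holomorphic_map V U \<psi> D M by fact
  have bij: "bij_betw \<phi> U V"
    by (rule bij_betw_byWitness[where f' = \<psi>]) (use inv f.maps g.maps in auto)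
  have "inv_into U \<phi> w = \<psi> w" if "w \<in> V" for w
    by (rule inv_into_f_eq[OF bij_betw_imp_inj_on[OF bij]]) (use that inv g.maps in auto)
  then have "smooth_on V (inv_into U \<phi>)"
    using smooth_on_cong_open[OF f.V(1) _ smooth_on_holomorphic[OF g.holo f.V(1)]] by metis
  then have diffeo: "diffeomorphism U V \<phi>"
    unfolding diffeomorphism_def using bij smooth_on_holomorphic[OF f.holo f.U(1)] by simp
  \<comment> \<open>Composing the two pullbacks recovers \<open>s\<close> on its domain only;
    elsewhere both sides are 0, because the empty list of derivatives is among the vanishing
    conditions.\<close>
  have vanish: "s x = 0" if "s \<in> schwartz_space_on W" "x \<notin> W" for s and x :: complex and W
    using that unfolding schwartz_space_on_def by (auto dest: bspec[where x = "[]"])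
  have "homeomorphic_maps (schwartz_topology_on V) (schwartz_topology_on U) (pullback U \<phi>) (pullback V \<psi>)"
    unfolding homeomorphic_maps_def
  proof (intro conjI ballI)
    show "pullback V \<psi> (pullback U \<phi> s) = s" if "s \<in> topspace (schwartz_topology_on V)" for s
      using that by (auto simp: pullback_def fun_eq_iff inv g.maps intro: vanish)
    show "pullback U \<phi> (pullback V \<psi> s) = s" if "s \<in> topspace (schwartz_topology_on U)" for s
      using that by (auto simp: pullback_def fun_eq_iff inv f.maps intro: vanish)
  qed (rule f.continuous_map_pullback g.continuous_map_pullback)+
  then have "homeomorphic_map (schwartz_topology_on V) (schwartz_topology_on U) (pullback U \<phi>)"
    by (auto simp: homeomorphic_map_maps)
  then have "schwartz_iso V U (pullback U \<phi>)"
    unfolding schwartz_iso_def by (auto simp: pullback_def fun_eq_iff)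
  with diffeo f.U f.V show ?thesis
    unfolding schwartz_equivalent_def by auto
qed

section \<open>Bounded turning\<close>

text \<open>The two-point condition in the form in which it is applied: a connected set inside
  \<open>J\<close> joins the two points, and its size is measured from \<open>x\<close> instead of
  by \<open>diameter\<close>.\<close>

definition bounded_turning :: "real \<Rightarrow> complex set \<Rightarrow> bool" where
  "bounded_turning C J \<longleftrightarrow> (\<forall>x\<in>J. \<forall>y\<in>J. \<exists>A. connected A \<and> A \<subseteq> J \<and> x \<in> A \<and> y \<in> A \<and> A \<subseteq> cball x (C * dist x y))"

text \<open>A compact \<open>J\<close> is closed in the Riemann sphere, so the closure does not
  acquire the point at infinity; as \<open>Some\<close> is an embedding, the Jordan curve already
  lives in the plane.\<close>

lemma compact_jordan_curve_imp_simple_path: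
  assumes J: "compact J" "jordan_curve_in riemann_sphere (riemann_sphere closure_of (Some ` J))"
  obtains g where "simple_path g" "pathfinish g = pathstart g" "path_image g = J"
proof -
  have "closedin riemann_sphere (Some ` J)"
  proof (rule compactin_imp_closedin)
    show "Hausdorff_space riemann_sphere"
      by (simp add: Hausdorff_space_Alexandroff_compactification locally_compact_space_euclidean)
    show "compactin riemann_sphere (Some ` J)"
      by (rule image_compactin[OF _ continuous_map_Some]) (simp add: J)
  qed
  then have cl: "riemann_sphere closure_of (Some ` J) = Some ` J"
    by (simp add: closure_of_eq)
  have "homeomorphic_map euclidean (subtopology riemann_sphere (Some ` UNIV)) Some"
    using embedding_map_Some[of "euclidean :: complex topology"] by (simp add: embedding_map_def)
  then have "homeomorphic_map (top_of_set J) (subtopology (subtopology riemann_sphere (Some ` UNIV)) (Some ` J)) Some"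
    by (rule homeomorphic_map_subtopologies) auto
  then have "homeomorphic_map (top_of_set J) (subtopology riemann_sphere (Some ` J)) Some"
    by (simp add: subtopology_subtopology Int_absorb1 image_mono)
  then have "top_of_set J homeomorphic_space subtopology riemann_sphere (Some ` J)"
    using homeomorphic_space by blast
  also have "\<dots> homeomorphic_space top_of_set (sphere (0::complex) 1)"
    using J(2) by (simp add: jordan_curve_in_def cl)
  finally obtain k h where hk: "homeomorphic_maps (top_of_set J) (top_of_set (sphere (0::complex) 1)) k h"
    unfolding homeomorphic_space_def by blast
  have h: "continuous_on (sphere 0 1) h" "h ` sphere 0 1 = J" "inj_on h (sphere 0 1)"
  proof -
    have k: "continuous_map (top_of_set J) (top_of_set (sphere (0::complex) 1)) k"
      and h: "continuous_map (top_of_set (sphere (0::complex) 1)) (top_of_set J) h"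
      and kh: "\<And>x. x \<in> J \<Longrightarrow> h (k x) = x" "\<And>y. y \<in> sphere 0 1 \<Longrightarrow> k (h y) = y"
      using hk unfolding homeomorphic_maps_def by auto
    have kJ: "k ` J \<subseteq> sphere 0 1" and hS: "h ` sphere 0 1 \<subseteq> J" and ch: "continuous_on (sphere 0 1) h"
      using k h by (auto simp: continuous_map_in_subtopology)
    show "continuous_on (sphere 0 1) h" by (rule ch)
    show "h ` sphere 0 1 = J"
    proof
      show "J \<subseteq> h ` sphere 0 1"
      proof
        fix x assume "x \<in> J"
        then show "x \<in> h ` sphere 0 1" using kh(1) kJ by (intro image_eqI[of _ _ "k x"]) auto
      qed
    qed (rule hS)
    show "inj_on h (sphere 0 1)" by (rule inj_on_inverseI[of _ k]) (rule kh(2))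
  qed
  show ?thesis
  proof
    let ?c = "circlepath 0 1"
    have im: "path_image ?c = sphere 0 1" by simp
    show "simple_path (h \<circ> ?c)"
      by (rule simple_path_continuous_image)
        (use h in \<open>auto simp: simple_path_circlepath\<close>)
    show "pathfinish (h \<circ> ?c) = pathstart (h \<circ> ?c)"
      by (simp add: pathfinish_compose pathstart_compose)
    show "path_image (h \<circ> ?c) = J"
      using h by (simp add: path_image_compose)
  qed
qed

lemma arc_subset_closure_endless:
  assumes "arc u"
  shows "path_image u \<subseteq> closure (path_image u - {pathstart u, pathfinish u})"
proof -
  let ?T = "closure (path_image u - {pathstart u, pathfinish u})"
  have inj: "inj_on u {0..1}" and cont: "continuous_on {0..1} u"
    using assms by (auto simp: arc_def path_def)
  have "u ` closure {0<..<1} \<subseteq> ?T"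
  proof (rule image_closure_subset)
    show "u ` {0<..<1} \<subseteq> ?T"
      using inj by (intro order_trans[OF _ closure_subset])
        (auto simp: path_image_def pathstart_def pathfinish_def dest: inj_onD)
  qed (use cont in auto)
  then show ?thesis by (simp add: path_image_def)
qed

text \<open>The points \<open>x\<close> and \<open>y\<close> cut the curve into two open arcs, and a
  component of the rest that meets one of them contains it. Its closure then contains the arc with
  its end points, and closure does not change the diameter.\<close>

lemma component_contains_joining_arc:
  assumes g: "simple_path g" "pathfinish g = pathstart g" and J: "path_image g = (J :: complex set)"
    and xy: "x \<in> J" "y \<in> J" "x \<noteq> y" and K: "K \<in> components (J - {x, y})"
  obtains u where "arc u" "path_image u \<subseteq> J" "x \<in> path_image u" "y \<in> path_image u"
    "path_image u \<subseteq> closure K"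
proof -
  obtain u d where ud: "arc u" "arc d" "pathstart u = x" "pathfinish u = y"
    "pathstart d = y" "pathfinish d = x" "path_image u \<inter> path_image d = {x, y}"
    "path_image u \<union> path_image d = path_image g"
    using exists_double_arc[OF g] xy J by metis
  have K': "K \<noteq> {}" "K \<subseteq> J - {x, y}" "connected K"
    using K in_components_nonempty in_components_subset in_components_connected by blast+
  have sub: "path_image v \<subseteq> closure K" if v: "arc v" "path_image v \<subseteq> J"
    "{pathstart v, pathfinish v} = {x, y}" "K \<inter> (path_image v - {x, y}) \<noteq> {}" for v
  proof -
    have "connected (path_image v - {x, y})"
      using connected_simple_path_endless[OF arc_imp_simple_path[OF v(1)]] v(3) by simp
    then have "path_image v - {x, y} \<subseteq> K"
      using components_maximal[OF K, of "path_image v - {x, y}"] v by blast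
    then show ?thesis
      using arc_subset_closure_endless[OF v(1)] closure_mono v(3) by (metis subset_trans)
  qed
  have "K \<inter> (path_image u - {x, y}) \<noteq> {} \<or> K \<inter> (path_image d - {x, y}) \<noteq> {}"
    using K' ud(8) J by blast
  then show ?thesis
  proof
    assume "K \<inter> (path_image u - {x, y}) \<noteq> {}"
    then show ?thesis
      using that[OF ud(1)] sub[OF ud(1)] ud J pathstart_in_path_image[of u] pathfinish_in_path_image[of u] by auto
  next
    assume "K \<inter> (path_image d - {x, y}) \<noteq> {}"
    then show ?thesis
      using that[OF ud(2)] sub[OF ud(2)] ud J pathstart_in_path_image[of d] pathfinish_in_path_image[of d] by auto
  qed
qed

lemma quasicircle_bounded_turning:
  assumes J: "compact J" "quasicircle J"
  obtains C where "1 \<le> C" "bounded_turning C J"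
proof -
  obtain g where g: "simple_path g" "pathfinish g = pathstart g" "path_image g = J"
    using compact_jordan_curve_imp_simple_path[OF J(1)] J(2) unfolding quasicircle_def by metis
  obtain C where C: "C > 0" "\<And>x y. x \<in> J \<Longrightarrow> y \<in> J \<Longrightarrow> x \<noteq> y \<Longrightarrow>
     \<exists>K\<in>components (J - {x, y}). bounded K \<and> diameter K \<le> C * dist x y"
    using J(2) unfolding quasicircle_def by metis
  have "\<exists>A. connected A \<and> A \<subseteq> J \<and> x \<in> A \<and> y \<in> A \<and> A \<subseteq> cball x (max 1 C * dist x y)"
    if xy: "x \<in> J" "y \<in> J" for x y
  proof (cases "x = y")
    case True
    then show ?thesis using xy by (intro exI[of _ "{x}"]) auto
  next
    case False
    obtain K where K: "K \<in> components (J - {x, y})" "bounded K" "diameter K \<le> C * dist x y"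
      using C(2)[OF xy False] by auto
    obtain u where u: "arc u" "path_image u \<subseteq> J" "x \<in> path_image u" "y \<in> path_image u" "path_image u \<subseteq> closure K"
      using component_contains_joining_arc[OF g xy False K(1)] by metis
    show ?thesis
    proof (intro exI conjI)
      show "connected (path_image u)" by (rule connected_arc_image[OF u(1)])
      have "dist x a \<le> max 1 C * dist x y" if "a \<in> path_image u" for a
      proof -
        have "dist x a \<le> diameter (closure K)"
          using that u K(2) by (intro diameter_bounded_bound) auto
        also have "\<dots> \<le> C * dist x y" using K by (simp add: diameter_closure)
        also have "\<dots> \<le> max 1 C * dist x y" by (intro mult_right_mono) auto
        finally show ?thesis .
      qed
      then show "path_image u \<subseteq> cball x (max 1 C * dist x y)" by auto
    qed (use u in auto)
  qed
  then show ?thesis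
    using that[of "max 1 C"] unfolding bounded_turning_def by auto
qed

text \<open>The connecting sets all contain \<open>q\<close>, so their union is connected. It is the
  connected replacement for \<open>J \<inter> cball q r\<close>, which may fall into many
  pieces.\<close>

lemma bounded_turning_hull:
  assumes J: "closed J" "bounded_turning C J" and q: "q \<in> J" and "0 \<le> r" "0 \<le> C"
  obtains \<alpha> where "connected \<alpha>" "closed \<alpha>" "\<alpha> \<subseteq> J" "J \<inter> cball q r \<subseteq> \<alpha>" "\<alpha> \<subseteq> cball q (C * r)"
proof -
  have "\<forall>x\<in>J. \<exists>A. connected A \<and> A \<subseteq> J \<and> q \<in> A \<and> x \<in> A \<and> A \<subseteq> cball q (C * dist q x)"
    using J(2) q unfolding bounded_turning_def by blast
  then obtain A where A: "\<And>x. x \<in> J \<Longrightarrow> connected (A x)" "\<And>x. x \<in> J \<Longrightarrow> A x \<subseteq> J"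
    "\<And>x. x \<in> J \<Longrightarrow> q \<in> A x" "\<And>x. x \<in> J \<Longrightarrow> x \<in> A x" "\<And>x. x \<in> J \<Longrightarrow> A x \<subseteq> cball q (C * dist q x)"
    by metis
  let ?U = "\<Union>x\<in>J \<inter> cball q r. A x"
  show ?thesis
  proof
    have "q \<in> \<Inter>(A ` (J \<inter> cball q r))" using A(3) by auto
    then have "connected ?U"
      by (intro connected_Union) (use A(1) in auto)
    then show "connected (closure ?U)" by (rule connected_imp_connected_closure)
    show "closure ?U \<subseteq> J"
      by (rule closure_minimal) (use A(2) J(1) in auto)
    show "J \<inter> cball q r \<subseteq> closure ?U"
      by (rule order_trans[OF _ closure_subset]) (use A(4) in auto)
    have "A x \<subseteq> cball q (C * r)" if "x \<in> J \<inter> cball q r" for x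
    proof -
      have "C * dist q x \<le> C * r" using that \<open>0 \<le> C\<close> by (intro mult_left_mono) auto
      then show ?thesis using A(5)[of x] that by (auto simp: subset_iff intro: order_trans)
    qed
    then show "closure ?U \<subseteq> cball q (C * r)"
      by (intro closure_minimal UN_least) auto
  qed simp
qed

text \<open>The discs are added to \<open>J\<close> one at a time. Janiszewski's theorem applies at every step, since
  the new disc together with a small connected piece \<open>X\<close> of the old set meets the old set exactly
  in \<open>X\<close>.\<close>

lemma connected_component_avoiding_discs:
  fixes J :: "complex set"
  assumes J: "compact J" "bounded_turning C J" and C: "1 \<le> C"
    and cc: "connected_component (- J) w z0"
    and c: "0 < c" "5 * C * c < 1"
    and far: "\<And>q. q \<in> J \<Longrightarrow> 5 * C * (c * dist q w) < dist q z0"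
    and Q: "finite Q" "Q \<subseteq> J"
  shows "connected_component (- (J \<union> (\<Union>q\<in>Q. cball q (c * dist q w)))) w z0"
  using Q
proof induction
  case empty
  then show ?case using cc by simp
next
  case (insert q Q)
  let ?N = "\<lambda>q. cball q (c * dist q w)"
  let ?S = "J \<union> (\<Union>q\<in>Q. ?N q)"
  define r where "r = c * dist q w"
  have q: "q \<in> J" and Q: "Q \<subseteq> J" using insert by auto
  have "q \<noteq> w" using cc q connected_component_in by blast
  then have r: "0 < r" using c by (simp add: r_def)
  have c': "c < 1 / 5"
  proof -
    have "1 * (5 * c) \<le> C * (5 * c)" using C c by (intro mult_right_mono) auto
    moreover have "C * (5 * c) = 5 * C * c" by simp
    ultimately show ?thesis using c by linarith
  qed
  \<comment> \<open>Radius \<open>3 * r\<close> catches the points of \<open>J\<close> in the new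
    disc and also the centres of all earlier discs that meet it, so that these discs are attached to
    \<alpha>.\<close>
  obtain \<alpha> where \<alpha>: "connected \<alpha>" "closed \<alpha>" "\<alpha> \<subseteq> J" "J \<inter> cball q (3 * r) \<subseteq> \<alpha>" "\<alpha> \<subseteq> cball q (C * (3 * r))"
    using bounded_turning_hull[OF compact_imp_closed[OF J(1)] J(2) q, of "3 * r"] r C by auto
  define I where "I = {j \<in> Q. ?N j \<inter> ?N q \<noteq> {}}"
  define X where "X = \<alpha> \<union> \<Union>(?N ` I)"
  \<comment> \<open>The radii are \<open>c\<close> times a function with Lipschitz constant 1, and
    \<open>c < 1 / 5\<close>: solving the two inequalities gives at most \<open>5 / 2 * r\<close>
    for the centres and \<open>3 / 2 * r\<close> for the radii.\<close>
  have near: "dist q j \<le> 3 * r \<and> c * dist j w \<le> 2 * r" if j: "j \<in> I" for j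
  proof -
    obtain z where "z \<in> ?N j" "z \<in> ?N q"
      using j unfolding I_def by blast
    then have "dist j z \<le> c * dist j w" "dist q z \<le> r"
      by (simp_all add: r_def)
    then have 1: "dist q j \<le> c * dist j w + r"
      using dist_triangle2[of q j z] by simp
    have "c * dist j w \<le> c * (dist q j + dist q w)"
      using c dist_triangle3[of j w q] by (intro mult_left_mono) (auto simp: dist_commute)
    then have 2: "c * dist j w \<le> c * dist q j + r" by (simp add: r_def algebra_simps)
    have "c * dist q j \<le> (1/5) * dist q j" using c' by (intro mult_right_mono) auto
    then show ?thesis using 1 2 r by linarith
  qed
  have Xq: "q \<in> \<alpha>" using \<alpha>(4) q r by auto
  have XS: "X \<subseteq> ?S" using \<alpha>(3) by (auto simp: X_def I_def)
  have SX: "?S \<inter> ?N q \<subseteq> X"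
  proof
    fix z assume z: "z \<in> ?S \<inter> ?N q"
    show "z \<in> X"
    proof (cases "z \<in> J")
      case True
      then have "z \<in> J \<inter> cball q (3 * r)" using z r by (auto simp: r_def)
      then show ?thesis using \<alpha>(4) by (auto simp: X_def)
    next
      case False
      then obtain j where "j \<in> Q" "z \<in> ?N j" using z by blast
      moreover have "?N j \<inter> ?N q \<noteq> {}" using z \<open>z \<in> ?N j\<close> by blast
      ultimately show ?thesis unfolding X_def I_def by blast
    qed
  qed
  \<comment> \<open>\<open>5 * C * r\<close> dominates \<open>3 * C * r\<close>, the size of
    \<alpha>, and \<open>3 * r + 2 * r\<close>, the reach of the discs that meet the new
    one.\<close>
  have ball: "?N q \<union> X \<subseteq> cball q (5 * C * r)"
  proof -
    have "r \<le> 5 * C * r" "3 * C * r \<le> 5 * C * r" "5 * r \<le> 5 * C * r"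
      using C r by auto
    moreover have "?N j \<subseteq> cball q (5 * r)" if "j \<in> I" for j
    proof
      fix z assume "z \<in> ?N j"
      then have "dist j z \<le> 2 * r" using near[OF that] by auto
      then show "z \<in> cball q (5 * r)"
        using near[OF that] dist_triangle[of q z j] by auto
    qed
    ultimately show ?thesis
      using \<alpha>(5) unfolding X_def by (fastforce simp: r_def[symmetric])
  qed
  have conX: "connected X"
    unfolding X_def
  proof (rule connected_Un_UN[OF \<alpha>(1)])
    fix Y assume "Y \<in> ?N ` I"
    then obtain j where j: "j \<in> I" "Y = ?N j" by auto
    then have "j \<in> \<alpha>" using \<alpha>(4) near[OF j(1)] Q by (auto simp: I_def)
    then show "\<alpha> \<inter> Y \<noteq> {}" using j c by auto
  qed auto
  have "connected_component (- (?S \<union> (?N q \<union> X))) w z0"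
  proof (rule Janiszewski)
    show "compact ?S" using J(1) insert.hyps(1) by (intro compact_Un compact_UN) auto
    have "finite I" using insert.hyps(1) by (simp add: I_def)
    then show "closed (?N q \<union> X)"
      unfolding X_def using \<alpha>(2) by (intro closed_Un closed_Union) auto
    have "?S \<inter> (?N q \<union> X) = X" using XS SX by blast
    then show "connected (?S \<inter> (?N q \<union> X))" using conX by simp
    show "connected_component (- ?S) w z0" using insert.IH Q by simp
    \<comment> \<open>The set to be added lies in a disc about \<open>q\<close> that contains
      neither \<open>w\<close> nor \<open>z0\<close>, and the complement of a disc is
      connected.\<close>
    have "5 * C * (c * dist q w) < 1 * dist q w"
      using c \<open>q \<noteq> w\<close> by (simp add: mult.assoc[symmetric])
    then have "w \<in> - cball q (5 * C * r)" "z0 \<in> - cball q (5 * C * r)"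
      using far[OF q] by (auto simp: r_def)
    moreover have "connected (- cball q (5 * C * r))"
      by (rule connected_complement_bounded_convex) auto
    ultimately have "connected_component (- cball q (5 * C * r)) w z0"
      unfolding connected_component_def by blast
    then show "connected_component (- (?N q \<union> X)) w z0"
      by (rule connected_component_of_subset) (use ball in auto)
  qed
  moreover have "?S \<union> (?N q \<union> X) = J \<union> (\<Union>q\<in>insert q Q. ?N q)"
    using XS by auto
  ultimately show ?case by simp
qed

text \<open>By compactness finitely many half-size discs cover \<open>J\<close>, and the path avoids
  the corresponding full discs. A point closer to \<open>p\<close> than a quarter of the scale at
  \<open>p\<close> would lie in the full disc about a nearby centre \<open>q\<close>. The constant
  does not depend on the number of discs.\<close>

lemma carrot_path:
  fixes J :: "complex set"
  assumes J: "compact J" "bounded_turning C J" and C: "1 \<le> C"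
    and cc: "connected_component (- J) w z0"
    and c: "0 < c" "5 * C * c < 1"
    and far: "\<And>q. q \<in> J \<Longrightarrow> 5 * C * (c * dist q w) < dist q z0"
  obtains \<gamma> where "path \<gamma>" "pathstart \<gamma> = w" "pathfinish \<gamma> = z0"
    "\<And>z p. z \<in> path_image \<gamma> \<Longrightarrow> p \<in> J \<Longrightarrow> c / 4 * dist p w \<le> dist z p"
proof -
  have "w \<notin> J" using cc connected_component_in by blast
  have "J \<subseteq> (\<Union>q\<in>J. ball q (c / 2 * dist q w))"
  proof
    fix q assume "q \<in> J"
    then have "0 < dist q w" using \<open>w \<notin> J\<close> by auto
    then have "q \<in> ball q (c / 2 * dist q w)" using c by simp
    then show "q \<in> (\<Union>q\<in>J. ball q (c / 2 * dist q w))" using \<open>q \<in> J\<close> by blast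
  qed
  then obtain Q where Q: "Q \<subseteq> J" "finite Q" "J \<subseteq> (\<Union>q\<in>Q. ball q (c / 2 * dist q w))"
    by (rule compactE_image[OF J(1) open_ball])
  let ?S = "J \<union> (\<Union>q\<in>Q. cball q (c * dist q w))"
  have "open (- ?S)"
    using J(1) Q(2) by (intro open_Compl compact_imp_closed compact_Un compact_UN) auto
  moreover have "connected_component (- ?S) w z0"
    by (rule connected_component_avoiding_discs[OF J C cc c far Q(2,1)])
  ultimately have "path_component (- ?S) w z0"
    by (simp add: open_path_connected_component)
  then obtain \<gamma> where \<gamma>: "path \<gamma>" "path_image \<gamma> \<subseteq> - ?S" "pathstart \<gamma> = w" "pathfinish \<gamma> = z0"
    by (auto simp: path_component_def)
  have "c / 4 * dist p w \<le> dist z p" if z: "z \<in> path_image \<gamma>" and p: "p \<in> J" for z p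
  proof (rule ccontr)
    assume "\<not> ?thesis"
    then have 1: "dist z p < c / 4 * dist p w" by simp
    obtain q where q: "q \<in> Q" "dist q p < c / 2 * dist q w"
      using Q(3) p by auto
    have "1 * (5 * c) \<le> C * (5 * c)" using C c by (intro mult_right_mono) auto
    moreover have "C * (5 * c) = 5 * C * c" by simp
    ultimately have "c \<le> 1" using c by linarith
    then have "c / 2 * dist q w \<le> 1 * dist q w" using c by (intro mult_right_mono) auto
    then have "dist p w \<le> 2 * dist q w"
      using q(2) dist_triangle[of p w q] by (simp add: dist_commute)
    then have "c / 4 * dist p w \<le> c / 4 * (2 * dist q w)"
      using c by (intro mult_left_mono) auto
    then have "dist q z \<le> c * dist q w"
      using 1 q(2) dist_triangle[of q z p] by (simp add: dist_commute)
    then have "z \<in> ?S" using q(1) by auto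
    then show False using \<gamma>(2) z by blast
  qed
  then show ?thesis using that \<gamma> by blast
qed

section \<open>Growth of the conformal map at a boundary of bounded turning\<close>

text \<open>The image of \<open>G\<close> contains the interval from \<open>v x\<close> to
  \<open>v y\<close>, and each piece contributes at most an interval of length \<open>2 * h\<close>.
  Comparing Lebesgue measures avoids arranging the pieces in a chain along a path.\<close>

lemma real_interval_covered_length:
  fixes v :: "'a::topological_space \<Rightarrow> real"
  assumes G: "connected G" "continuous_on G v" and I: "finite I" "G \<subseteq> (\<Union>i\<in>I. B i)"
    and osc: "\<And>i x y. i \<in> I \<Longrightarrow> x \<in> B i \<inter> G \<Longrightarrow> y \<in> B i \<inter> G \<Longrightarrow> \<bar>v x - v y\<bar> \<le> h"
    and xy: "x \<in> G" "y \<in> G" and h: "0 \<le> h"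
  shows "v y - v x \<le> 2 * h * card I"
proof (cases "v x \<le> v y")
  case True
  define b where "b = (\<lambda>i. SOME z. z \<in> B i \<inter> G)"
  have "v z \<in> (\<Union>i\<in>I. {v (b i) - h..v (b i) + h})" if "z \<in> G" for z
  proof -
    obtain i where i: "i \<in> I" "z \<in> B i" using I(2) \<open>z \<in> G\<close> by auto
    then have "z \<in> B i \<inter> G" using \<open>z \<in> G\<close> by simp
    then have "b i \<in> B i \<inter> G" unfolding b_def by (rule someI)
    then have "\<bar>v z - v (b i)\<bar> \<le> h" using osc[OF i(1) \<open>z \<in> B i \<inter> G\<close>] by simp
    then show ?thesis using i(1) by (intro UN_I[of i]) (auto simp: abs_le_iff)
  qed
  moreover have "{v x..v y} \<subseteq> v ` G"
    using connected_contains_Icc[OF connected_continuous_image[OF G(2,1)]] xy by blast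
  ultimately have "{v x..v y} \<subseteq> (\<Union>i\<in>I. {v (b i) - h..v (b i) + h})" by blast
  then have "measure lborel {v x..v y} \<le> measure lborel (\<Union>i\<in>I. {v (b i) - h..v (b i) + h})"
    using I(1) fmeasurable_cbox[where 'a=real]
    by (intro measure_mono_fmeasurable fmeasurable.finite_UN) (auto simp: box_real)
  also have "\<dots> \<le> (\<Sum>i\<in>I. measure lborel {v (b i) - h..v (b i) + h})"
    by (rule measure_UNION_le[OF I(1)]) auto
  also have "\<dots> = 2 * h * card I" using h by simp
  finally show ?thesis using True by simp
next
  case False
  have "0 \<le> 2 * h * card I" using h by simp
  then show ?thesis using False by linarith
qed

text \<open>The Schwarz lemma is applied to a Cayley transform of a branch of \<open>ln \<phi>\<close>.\<close>

lemma harnack_ln_norm: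
  assumes holo: "\<phi> holomorphic_on ball z d" and gt: "\<And>y. y \<in> ball z d \<Longrightarrow> 1 < norm (\<phi> y)"
    and d: "0 < d" and y: "dist z y \<le> d / 2"
  shows "ln (norm (\<phi> y)) \<le> 3 * ln (norm (\<phi> z))" "ln (norm (\<phi> z)) \<le> 3 * ln (norm (\<phi> y))"
proof -
  have nz: "\<phi> y \<noteq> 0" if "y \<in> ball z d" for y
    using gt[OF that] by auto
  obtain l where l: "l holomorphic_on ball z d" "\<And>y. y \<in> ball z d \<Longrightarrow> exp (l y) = \<phi> y"
    using holomorphic_logarithm_exists[OF convex_ball open_ball holo nz, of z] d by auto
  have Rel: "Re (l y) = ln (norm (\<phi> y))" if "y \<in> ball z d" for y
    using l(2)[OF that] by (metis ln_exp norm_exp_eq_Re)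
  have pos: "0 < Re (l y)" if "y \<in> ball z d" for y
    unfolding Rel[OF that] using gt[OF that] by (rule ln_gt_zero)
  define a where "a = l z"
  define g where "g = (\<lambda>\<xi>::complex. (l (z + d * \<xi>) - a) / (l (z + d * \<xi>) + cnj a))"
  have a: "0 < Re a" unfolding a_def using pos d by simp
  have inb: "z + d * \<xi> \<in> ball z d" if "norm \<xi> < 1" for \<xi> :: complex
    using that d by (simp add: dist_norm norm_mult)
  have less: "norm (g \<xi>) < 1" if "norm \<xi> < 1" for \<xi> :: complex
  proof -
    let ?L = "l (z + d * \<xi>)"
    have p: "0 < Re ?L" by (rule pos[OF inb[OF that]])
    then have "0 < Re ?L * Re a" using a by simp
    then have "(norm (?L - a))\<^sup>2 < (norm (?L + cnj a))\<^sup>2"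
      unfolding cmod_power2 by (simp add: power2_eq_square algebra_simps)
    then have "norm (?L - a) < norm (?L + cnj a)"
      by (rule power2_less_imp_less) simp
    then show ?thesis
      unfolding g_def norm_divide by (subst divide_less_eq_1_pos) (auto intro: le_less_trans[OF norm_ge_zero])
  qed
  have holg: "g holomorphic_on ball 0 1"
  proof -
    have "(\<lambda>\<xi>. l (z + d * \<xi>)) holomorphic_on ball 0 1"
      by (rule holomorphic_on_compose_gen[of "\<lambda>\<xi>. z + d * \<xi>" _ l, unfolded o_def, OF _ l(1)])
        (use inb in \<open>auto intro!: holomorphic_intros\<close>)
    moreover have "l (z + d * \<xi>) + cnj a \<noteq> 0" if "\<xi> \<in> ball 0 1" for \<xi> :: complex
    proof -
      have "0 < Re (l (z + d * \<xi>) + cnj a)" using pos[OF inb[of \<xi>]] that a by simp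
      then show ?thesis by (metis less_irrefl zero_complex.simps(1))
    qed
    ultimately show ?thesis unfolding g_def by (intro holomorphic_intros) auto
  qed
  define \<xi> where "\<xi> = (y - z) / d"
  have \<xi>: "norm \<xi> \<le> 1 / 2" "z + d * \<xi> = y"
    using y d by (auto simp: \<xi>_def norm_divide dist_norm norm_minus_commute field_simps)
  have "g 0 = 0" by (simp add: g_def a_def)
  then have "norm (g \<xi>) \<le> norm \<xi>"
    using Schwarz_Lemma(1)[OF holg _ less, of \<xi>] \<xi>(1) by simp
  then have "norm (g \<xi>) \<le> 1 / 2" using \<xi>(1) by simp
  moreover have yb: "y \<in> ball z d" using y d by auto
  moreover have "0 < norm (l y + cnj a)"
  proof -
    have "0 < Re (l y + cnj a)" using pos[OF yb] a by simp
    then have "l y + cnj a \<noteq> 0" by (metis less_irrefl zero_complex.simps(1))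
    then show ?thesis by simp
  qed
  ultimately have "norm (l y - a) \<le> 1 / 2 * norm (l y + cnj a)"
    unfolding g_def \<xi>(2) norm_divide by (simp add: divide_le_eq)
  then have "(2 * norm (l y - a))\<^sup>2 \<le> (norm (l y + cnj a))\<^sup>2"
    by (intro power_mono) auto
  then have "4 * ((Re (l y) - Re a)\<^sup>2 + (Im (l y) - Im a)\<^sup>2) \<le> (Re (l y) + Re a)\<^sup>2 + (Im (l y) - Im a)\<^sup>2"
    unfolding power_mult_distrib cmod_power2 by simp
  moreover have "0 \<le> (Im (l y) - Im a)\<^sup>2" by simp
  ultimately have "4 * (Re (l y) - Re a)\<^sup>2 \<le> (Re (l y) + Re a)\<^sup>2" unfolding distrib_left by linarith
  then have "(2 * \<bar>Re (l y) - Re a\<bar>)\<^sup>2 \<le> (Re (l y) + Re a)\<^sup>2"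
    by (simp add: power_mult_distrib)
  then have "2 * \<bar>Re (l y) - Re a\<bar> \<le> Re (l y) + Re a"
    by (rule power2_le_imp_le) (use pos[OF yb] a in auto)
  then have "Re (l y) \<le> 3 * Re a \<and> Re a \<le> 3 * Re (l y)"
    using abs_ge_self[of "Re (l y) - Re a"] abs_ge_minus_self[of "Re (l y) - Re a"] by argo
  then show "ln (norm (\<phi> y)) \<le> 3 * ln (norm (\<phi> z))" "ln (norm (\<phi> z)) \<le> 3 * ln (norm (\<phi> y))"
    using Rel[OF yb] Rel[of z] d by (auto simp: a_def)
qed

text \<open>Along a path as in \<open>carrot_path\<close> the function \<open>ln ln \<bar>\<phi>\<bar>\<close> changes by a bounded amount on each
  dyadic annulus around the initial point, up to the scale of \<open>R\<close>.\<close>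

theorem bounded_turning_lower_growth:
  fixes U :: "complex set"
  assumes J: "compact J" "bounded_turning C J" and C: "1 \<le> C"
    and JR: "J \<subseteq> ball 0 R" "J \<noteq> {}"
    and U: "open U" "connected U" "U \<inter> J = {}" "frontier U \<subseteq> J" "- ball 0 R \<subseteq> U"
    and holo: "\<phi> holomorphic_on U" and gt: "\<And>z. z \<in> U \<Longrightarrow> 1 < norm (\<phi> z)"
  obtains K M where "0 < K" "\<And>w. w \<in> U \<Longrightarrow> norm w < R \<Longrightarrow> infdist w J ^ M \<le> K * (norm (\<phi> w) - 1)"
proof -
  obtain p0 where p0: "p0 \<in> J" using JR(2) by blast
  have "norm p0 < R" using p0 JR(1) by auto
  then have R: "0 < R" using norm_ge_zero[of p0] by linarith
  \<comment> \<open>Makes \<open>5 * C * c\<close> equal to 1/2; as points of \<open>J\<close> are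
    within \<open>2 * R\<close> of \<open>w\<close>, a target \<open>z0\<close> of norm
    \<open>4 * R\<close> is far enough.\<close>
  define c where "c = 1 / (10 * C)"
  have c: "0 < c" "5 * C * c < 1" using C by (auto simp: c_def)
  have c1: "c \<le> 1" using C by (simp add: c_def)
  define e where "e = c / 4"
  have e: "0 < e" "e \<le> 1" using c c1 by (auto simp: e_def)
  define z0 where "z0 = complex_of_real (4 * R)"
  have z0: "norm z0 = 4 * R" using R by (simp add: z0_def)
  have zU: "z \<in> U" if "R \<le> norm z" for z using U(5) that by auto
  \<comment> \<open>Scaled by \<open>s\<close>, two points of one piece of this net are at distance
    less than \<open>e / 8 * s\<close>, half of their clearance \<open>e / 4 * s\<close> from
    \<open>J\<close>, as Harnack's inequality asks. \<open>F\<close> is fixed before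
    \<open>w\<close>, so its size bounds the number of pieces at every scale.\<close>
  have "cball (0::complex) 1 \<subseteq> (\<Union>f\<in>cball 0 1. ball f (e / 16))"
    using e by (intro subsetI UN_I) auto
  then obtain F where F: "F \<subseteq> cball 0 1" "finite F" "cball (0::complex) 1 \<subseteq> (\<Union>f\<in>F. ball f (e / 16))"
    by (rule compactE_image[OF compact_cball open_ball])
  have lnpos: "0 < ln (norm (\<phi> z))" if "z \<in> U" for z
    by (rule ln_gt_zero[OF gt[OF that]])
  have contln: "continuous_on U (\<lambda>z. ln (norm (\<phi> z)))"
    using gt by (intro continuous_on_ln continuous_on_norm holomorphic_on_imp_continuous_on[OF holo]) force
  obtain m where m: "0 < m" "\<And>z. norm z = R \<Longrightarrow> m \<le> ln (norm (\<phi> z))"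
  proof -
    have "sphere (0::complex) R \<noteq> {}" using R by simp
    then obtain x where x: "x \<in> sphere 0 R" "\<And>z. z \<in> sphere 0 R \<Longrightarrow> ln (norm (\<phi> x)) \<le> ln (norm (\<phi> z))"
      using continuous_attains_inf[OF compact_sphere, of 0 R "\<lambda>z. ln (norm (\<phi> z))"]
        continuous_on_subset[OF contln, of "sphere 0 R"] zU by force
    show ?thesis by (rule that[of "ln (norm (\<phi> x))"]) (use x zU lnpos in auto)
  qed
  \<comment> \<open>One dyadic scale costs at most the factor \<open>3 ^ (2 * card F)\<close>, which
    is below \<open>2 ^ (4 * card F)\<close> because 9 < 16; powers of 2 per scale become powers of
    the distance.\<close>
  define M where "M = 4 * card F"
  have main: "m * infdist w J ^ M \<le> (8 * R) ^ M * (norm (\<phi> w) - 1)" if w: "w \<in> U" "norm w < R" for w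
  proof -
    define \<delta> where "\<delta> = infdist w J"
    have "infdist w J \<noteq> 0"
      using in_closed_iff_infdist_zero[OF compact_imp_closed[OF J(1)] JR(2), of w] w(1) U(3) by auto
    then have \<delta>: "0 < \<delta>" using infdist_nonneg[of w J] by (simp add: \<delta>_def)
    have \<delta>le: "\<delta> \<le> dist p w" if "p \<in> J" for p
      using infdist_le[OF that, of w] by (simp add: \<delta>_def dist_commute)
    have pw: "dist p w < 2 * R" if "p \<in> J" for p
    proof -
      have "norm p < R" using JR(1) that by auto
      then show ?thesis using norm_triangle_ineq4[of p w] w(2) by (simp add: dist_norm)
    qed
    have cc: "connected_component (- J) w z0"
      unfolding connected_component_def
      using U(2,3) w(1) zU[of z0] z0 R by (intro exI[of _ U]) auto
    have far: "5 * C * (c * dist q w) < dist q z0" if "q \<in> J" for q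
    proof -
      have "norm q < R" using JR(1) that by auto
      then have "3 * R < dist q z0" using norm_triangle_ineq3[of q z0] z0 by (simp add: dist_norm)
      moreover have "5 * C * c = 1 / 2" using C by (simp add: c_def)
      then have "5 * C * (c * dist q w) = dist q w / 2" by (simp add: mult.assoc[symmetric])
      ultimately show ?thesis using pw[OF that] R by linarith
    qed
    obtain \<gamma> where \<gamma>: "path \<gamma>" "pathstart \<gamma> = w" "pathfinish \<gamma> = z0"
      "\<And>z p. z \<in> path_image \<gamma> \<Longrightarrow> p \<in> J \<Longrightarrow> c / 4 * dist p w \<le> dist z p"
      using carrot_path[OF J C cc c far] by metis
    \<comment> \<open>The path is kept in the disc of radius \<open>R\<close> and stopped on its
      circle, where \<open>m\<close> bounds \<open>ln (norm (\<phi> z))\<close> from below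
      independently of \<open>w\<close>.\<close>
    obtain \<eta> where \<eta>: "path \<eta>" "pathstart \<eta> = pathstart \<gamma>" "path_image \<eta> \<subseteq> path_image \<gamma> \<inter> cball 0 R"
      "pathfinish \<eta> \<in> frontier (cball 0 R)"
      by (rule exists_path_subpath_to_frontier_closed[of "cball 0 R" \<gamma>]) (use \<gamma> w z0 R in auto)
    define G where "G = path_image \<eta>"
    have conG: "connected G" unfolding G_def by (rule connected_path_image[OF \<eta>(1)])
    have wG: "w \<in> G" unfolding G_def using pathstart_in_path_image[of \<eta>] \<eta>(2) \<gamma>(2) by simp
    define z1 where "z1 = pathfinish \<eta>"
    have z1: "z1 \<in> G" "norm z1 = R"
      unfolding G_def z1_def using \<eta>(4) R by auto
    have GJ: "e * dist p w \<le> dist z p" if "z \<in> G" "p \<in> J" for z p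
      using \<gamma>(4)[of z p] that \<eta>(3) unfolding G_def e_def by auto
    have GnotJ: "G \<inter> J = {}"
    proof -
      have False if "z \<in> G" "z \<in> J" for z
        using GJ[OF that] \<delta>le[OF that(2)] \<delta> e by (simp add: mult_le_0_iff)
      then show ?thesis by blast
    qed
    have GU: "G \<subseteq> U"
    proof (rule ccontr)
      assume "\<not> G \<subseteq> U"
      then have "G \<inter> frontier U \<noteq> {}"
        by (intro connected_Int_frontier[OF conG]) (use wG w in auto)
      then show False using GnotJ U(4) by blast
    qed
    \<comment> \<open>The clearance from \<open>J\<close> is compared with \<delta>, for the
      innermost disc, and with the distance to \<open>w\<close>, for the annuli.\<close>
    have far1: "e / 2 * \<delta> \<le> dist z p" "e / 2 * dist z w \<le> dist z p" if zp: "z \<in> G" "p \<in> J" for z p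
    proof -
      have 1: "e * dist p w \<le> dist z p" by (rule GJ[OF zp])
      have "e * \<delta> \<le> e * dist p w" using \<delta>le[OF zp(2)] e by (intro mult_left_mono) auto
      then show "e / 2 * \<delta> \<le> dist z p" using 1 mult_pos_pos[OF e(1) \<delta>] by simp
      have "e * dist z w \<le> e * (dist z p + dist p w)"
        using dist_triangle[of z w p] e by (intro mult_left_mono) auto
      also have "\<dots> \<le> 1 * dist z p + e * dist p w"
        unfolding distrib_left using e by (intro add_mono mult_right_mono) auto
      finally show "e / 2 * dist z w \<le> dist z p" using 1 by simp
    qed
    have ballU: "ball z d \<subseteq> U" if z: "z \<in> G" and d: "\<And>p. p \<in> J \<Longrightarrow> d \<le> dist z p" "0 < d" for z d
    proof (rule ccontr)
      assume "\<not> ball z d \<subseteq> U"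
      then have "ball z d - U \<noteq> {}" by blast
      moreover have "z \<in> ball z d \<inter> U" using d z GU by auto
      then have "ball z d \<inter> U \<noteq> {}" by blast
      ultimately have "ball z d \<inter> frontier U \<noteq> {}"
        by (intro connected_Int_frontier[OF connected_ball])
      then obtain p where "p \<in> ball z d" "p \<in> J" using U(4) by blast
      then show False using d(1)[of p] by auto
    qed
    define v where "v = (\<lambda>z. ln (ln (norm (\<phi> z))))"
    have contv: "continuous_on G v"
      unfolding v_def using lnpos GU
      by (intro continuous_on_ln continuous_on_subset[OF contln]) force+
    have osc: "\<bar>v x - v y\<bar> \<le> ln 3"
      if "x \<in> G" "y \<in> G" and d: "\<And>p. p \<in> J \<Longrightarrow> d \<le> dist x p" "0 < d" and xy: "dist x y \<le> d / 2" for x y d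
    proof -
      have b: "ball x d \<subseteq> U" by (rule ballU[OF \<open>x \<in> G\<close> d])
      have H: "ln (norm (\<phi> y)) \<le> 3 * ln (norm (\<phi> x))" "ln (norm (\<phi> x)) \<le> 3 * ln (norm (\<phi> y))"
        using harnack_ln_norm[OF holomorphic_on_subset[OF holo b] gt[OF subsetD[OF b]] d(2) xy] by auto
      have px: "0 < ln (norm (\<phi> x))" and py: "0 < ln (norm (\<phi> y))"
        using lnpos GU that(1,2) by auto
      have "v y \<le> ln (3 * ln (norm (\<phi> x)))" "v x \<le> ln (3 * ln (norm (\<phi> y)))"
        unfolding v_def using H px py by (subst ln_le_cancel_iff; simp)+
      then have "v y \<le> ln 3 + v x" "v x \<le> ln 3 + v y"
        using px py by (simp_all add: v_def ln_mult)
      then show ?thesis by linarith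
    qed
    define n where "n = (LEAST n. 2 * R \<le> 2 ^ n * \<delta>)"
    have "\<exists>n. 2 * R \<le> 2 ^ n * \<delta>"
    proof -
      obtain n where "2 * R / \<delta> < 2 ^ n" using real_arch_pow[of 2 "2 * R / \<delta>"] by auto
      then show ?thesis using \<delta> by (intro exI[of _ n]) (simp add: field_simps)
    qed
    then have n: "2 * R \<le> 2 ^ n * \<delta>" unfolding n_def by (rule LeastI_ex)
    \<comment> \<open>Since \<delta> is below \<open>2 * R\<close>, \<open>n\<close> is positive,
      and its minimality gives \<open>2 ^ n * \<delta> < 4 * R\<close>.\<close>
    have "\<not> 2 * R \<le> 2 ^ 0 * \<delta>" using \<delta>le[OF p0] pw[OF p0] by simp
    then have "n \<noteq> 0" using n by (intro notI) simp
    then have "\<not> 2 * R \<le> 2 ^ (n - 1) * \<delta>"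
      unfolding n_def by (intro not_less_Least) (auto simp: n_def)
    then have n2: "2 ^ Suc n * \<delta> \<le> 8 * R"
      using \<open>n \<noteq> 0\<close> by (cases n) (auto simp: mult.commute not_le intro: less_imp_le)
    \<comment> \<open>Level 0 is the disc of radius \<delta> about \<open>w\<close>; a level
      \<open>k > 0\<close> is the annulus of outer radius \<open>2 ^ k * \<delta>\<close> and half
      that inner radius. Each is cut up by the scaled net.\<close>
    define A where "A = (\<lambda>(k::nat, f). {z. dist z w \<le> 2 ^ k * \<delta> \<and> (k = 0 \<or> 2 ^ k * \<delta> \<le> 2 * dist z w)}
      \<inter> ball (w + (2 ^ k * \<delta>) *\<^sub>R f) (e / 16 * (2 ^ k * \<delta>)))"
    have "v z1 - v w \<le> 2 * ln 3 * card ({0..n} \<times> F)"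
    proof (rule real_interval_covered_length[OF conG contv, where B = A])
      show "finite ({0..n} \<times> F)" using F(2) by simp
      show "w \<in> G" "z1 \<in> G" by (fact wG, fact z1(1))
      show "G \<subseteq> (\<Union>i\<in>{0..n} \<times> F. A i)"
      proof
        fix z assume z: "z \<in> G"
        have "norm z \<le> R" using z \<eta>(3) by (auto simp: G_def)
        then have zw: "dist z w \<le> 2 ^ n * \<delta>"
          using n w(2) norm_triangle_ineq4[of z w] by (simp add: dist_norm)
        define k where "k = (LEAST k. dist z w \<le> 2 ^ k * \<delta>)"
        have k1: "dist z w \<le> 2 ^ k * \<delta>" unfolding k_def by (rule LeastI[of _ n]) (rule zw)
        have kn: "k \<le> n" unfolding k_def by (rule Least_le) (rule zw)
        have k2: "k = 0 \<or> 2 ^ k * \<delta> \<le> 2 * dist z w"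
        proof (cases k)
          case (Suc j)
          then have "\<not> dist z w \<le> 2 ^ j * \<delta>"
            using not_less_Least[of j "\<lambda>k. dist z w \<le> 2 ^ k * \<delta>"] by (simp add: k_def)
          then show ?thesis using Suc by simp
        qed simp
        define s where "s = 2 ^ k * \<delta>"
        have s: "0 < s" using \<delta> by (simp add: s_def)
        have "norm ((z - w) /\<^sub>R s) \<le> 1"
          using k1 s by (simp add: s_def[symmetric] dist_norm divide_simps)
        then have "(z - w) /\<^sub>R s \<in> cball 0 1" unfolding mem_cball_0 .
        then obtain f where f: "f \<in> F" "(z - w) /\<^sub>R s \<in> ball f (e / 16)"
          using F(3) by blast
        have "w + s *\<^sub>R f - z = s *\<^sub>R (f - (z - w) /\<^sub>R s)"
          using s by (simp add: algebra_simps)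
        then have "norm (w + s *\<^sub>R f - z) = s * norm (f - (z - w) /\<^sub>R s)"
          using s by simp
        also have "\<dots> < s * (e / 16)"
          using f(2) s by (intro mult_strict_left_mono) (auto simp: dist_norm)
        finally have "dist (w + s *\<^sub>R f) z < e / 16 * s"
          by (simp add: dist_norm mult.commute)
        then have "z \<in> A (k, f)"
          unfolding A_def using k1 k2 by (simp add: s_def)
        then show "z \<in> (\<Union>i\<in>{0..n} \<times> F. A i)" using f(1) kn by auto
      qed
      show "0 \<le> ln (3::real)" by simp
      fix i x y assume "i \<in> {0..n} \<times> F" and xy: "x \<in> A i \<inter> G" "y \<in> A i \<inter> G"
      obtain k f where i: "i = (k, f)" by (cases i)
      define s where "s = 2 ^ k * \<delta>"
      have s: "0 < s" using \<delta> by (simp add: s_def)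
      have x: "k = 0 \<or> s \<le> 2 * dist x w" "dist (w + s *\<^sub>R f) x < e / 16 * s"
        and y: "dist (w + s *\<^sub>R f) y < e / 16 * s"
        using xy unfolding i A_def s_def by auto
      have xJ: "e / 4 * s \<le> dist x p" if p: "p \<in> J" for p
      proof (cases "k = 0")
        case True
        then have "e / 4 * s \<le> e / 2 * \<delta>" using mult_pos_pos[OF \<delta> e(1)] by (simp add: s_def mult.commute)
        then show ?thesis using far1(1)[of x p] xy p by simp
      next
        case False
        then have "e / 4 * s \<le> e / 4 * (2 * dist x w)" using x(1) e by (intro mult_left_mono) auto
        then show ?thesis using far1(2)[of x p] xy p by simp
      qed
      have "dist x y \<le> e / 4 * s / 2"
        using dist_triangle3[of x y "w + s *\<^sub>R f"] x(2) y by simp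
      then show "\<bar>v x - v y\<bar> \<le> ln 3"
        using xJ xy e s by (intro osc[of x y "e / 4 * s"]) auto
    qed
    then have vv: "v z1 \<le> v w + real (2 * (Suc n * card F)) * ln 3"
      by (simp add: card_cartesian_product algebra_simps)
    have pw': "0 < ln (norm (\<phi> w))" by (rule lnpos[OF w(1)])
    have three: "(3::real) ^ (2 * k) = 9 ^ k" for k by (simp add: power_mult)
    have "ln (norm (\<phi> z1)) = exp (v z1)"
      unfolding v_def using lnpos GU z1(1) by (subst exp_ln) auto
    also have "\<dots> \<le> exp (v w + real (2 * (Suc n * card F)) * ln 3)" using vv by simp
    also have "\<dots> = ln (norm (\<phi> w)) * 3 ^ (2 * (Suc n * card F))"
      unfolding exp_add v_def using pw' by (subst exp_of_nat_mult) simp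
    also have "3 ^ (2 * (Suc n * card F)) = (9::real) ^ (Suc n * card F)"
      by (rule three)
    also have "ln (norm (\<phi> w)) * 9 ^ (Suc n * card F) \<le> ln (norm (\<phi> w)) * 16 ^ (Suc n * card F)"
      using pw' by (intro mult_left_mono power_mono) auto
    also have "16 ^ (Suc n * card F) = ((2::real) ^ Suc n) ^ M"
    proof -
      have "((2::real) ^ Suc n) ^ M = (2 ^ 4) ^ (Suc n * card F)"
        unfolding M_def power_mult[symmetric] by (simp add: algebra_simps)
      then show ?thesis by simp
    qed
    finally have "m \<le> ln (norm (\<phi> w)) * (2 ^ Suc n) ^ M"
      using m(2)[OF z1(2)] by linarith
    then have "m * \<delta> ^ M \<le> (ln (norm (\<phi> w)) * (2 ^ Suc n) ^ M) * \<delta> ^ M"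
      using \<delta> by (intro mult_right_mono) auto
    also have "\<dots> = ln (norm (\<phi> w)) * (2 ^ Suc n * \<delta>) ^ M"
      by (simp add: power_mult_distrib)
    also have "\<dots> \<le> ln (norm (\<phi> w)) * (8 * R) ^ M"
      using pw' n2 \<delta> by (intro mult_left_mono power_mono) auto
    also have "\<dots> \<le> (norm (\<phi> w) - 1) * (8 * R) ^ M"
      using R gt[OF w(1)] by (intro mult_right_mono ln_le_minus_one) auto
    finally show ?thesis by (simp add: \<delta>_def mult.commute)
  qed
  show ?thesis
  proof
    show "0 < (8 * R) ^ M / m" using R m by simp
    fix w assume "w \<in> U" "norm w < R"
    from main[OF this] show "infdist w J ^ M \<le> (8 * R) ^ M / m * (norm (\<phi> w) - 1)"
      using m(1) by (simp add: pos_le_divide_eq mult.commute)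
  qed
qed

section \<open>Conformal maps of exterior domains\<close>

text \<open>A branch of \<open>ln (f - p)\<close> takes no two values that differ by \<open>2 \<pi> \<i>\<close>, so its image contains no
  large disc; Bloch's theorem then bounds its derivative.\<close>

lemma univalent_omitted_value_lower_bound:
  assumes holo: "f holomorphic_on ball 0 1" and inj: "inj_on f (ball 0 1)"
    and p: "p \<notin> f ` ball 0 1" and t: "norm t < 1"
  shows "norm (f 0 - p) * (1 - norm t) ^ 96 \<le> norm (f t - p)"
proof -
  obtain L where L: "L holomorphic_on ball 0 1" "\<And>s. s \<in> ball 0 1 \<Longrightarrow> exp (L s) = f s - p"
  proof (rule holomorphic_logarithm_exists[of "ball 0 1" "\<lambda>s. f s - p" 0])
    show "(\<lambda>s. f s - p) holomorphic_on ball 0 1" by (intro holomorphic_intros holo)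
    show "f s - p \<noteq> 0" if "s \<in> ball 0 1" for s using p that by auto
  qed auto
  have dL: "norm (deriv L s) * (1 - norm s) \<le> 96" if s: "s \<in> ball 0 1" for s
  proof (rule ccontr)
    assume "\<not> ?thesis"
    \<comment> \<open>Bloch's theorem yields a disc of radius
      \<open>(1 - norm s) * norm (deriv L s) / 12\<close>; 8 exceeds \<open>2 * pi\<close>, and 96
      is 8 times 12.\<close>
    then have le: "8 \<le> (1 - norm s) * norm (deriv L s) / 12" by (simp add: mult.commute)
    have fr: "1 - norm s \<le> dist s z" if "z \<in> frontier (ball 0 1)" for z
      using that norm_triangle_ineq2[of z s] by (simp add: dist_norm norm_minus_commute)
    obtain b where b: "ball b 8 \<subseteq> L ` ball 0 1"
      by (rule Bloch_general[OF L(1) s fr le])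
    have "dist b (b + 2 * pi * \<i>) < 8"
      using pi_less_4 by (simp add: dist_norm norm_mult)
    then have "b \<in> L ` ball 0 1" "b + 2 * pi * \<i> \<in> L ` ball 0 1"
      using b by auto
    then obtain s1 s2 where s12: "s1 \<in> ball 0 1" "L s1 = b" "s2 \<in> ball 0 1" "L s2 = b + 2 * pi * \<i>"
      by auto
    have "exp (L s1) = exp (L s2)"
      using s12 by (simp add: exp_add exp_two_pi_i' mult.commute)
    then have "f s1 = f s2" using L(2)[OF s12(1)] L(2)[OF s12(3)] by simp
    then have "s1 = s2" using inj s12 by (auto dest: inj_onD)
    then show False using s12 by simp
  qed
  \<comment> \<open>The derivative bound is integrated along the radius, phrased as monotonicity:
    the logarithmic term grows at least as fast as \<open>Re L\<close> can decrease.\<close>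
  have "Re (L (of_real 0 * t)) - 96 * ln (1 - 0 * norm t) \<le> Re (L (of_real 1 * t)) - 96 * ln (1 - 1 * norm t)"
  proof (rule DERIV_nonneg_imp_nondecreasing[where f = "\<lambda>x. Re (L (of_real x * t)) - 96 * ln (1 - x * norm t)"])
    fix x :: real assume x: "0 \<le> x" "x \<le> 1"
    let ?s = "of_real x * t"
    have xt: "x * norm t < 1" using x t mult_left_le_one_le[of "norm t" x] by simp
    then have s: "?s \<in> ball 0 1" using x by (simp add: norm_mult)
    have "(L has_field_derivative deriv L ?s) (at ?s)"
      by (rule holomorphic_derivI[OF L(1) open_ball s])
    then have "((\<lambda>x. L (of_real x * t)) has_vector_derivative t * deriv L ?s) (at x)"
      by (rule field_vector_diff_chain_at[unfolded o_def, rotated]) (auto intro!: derivative_eq_intros)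
    then have "((\<lambda>x. Re (L (of_real x * t))) has_real_derivative Re (t * deriv L ?s)) (at x)"
      unfolding has_real_derivative_iff_has_vector_derivative has_vector_derivative_complex_iff
      by (rule conjunct1)
    moreover have "((\<lambda>x. 96 * ln (1 - x * norm t)) has_real_derivative - (96 * (norm t / (1 - x * norm t)))) (at x)"
      using xt by (auto intro!: derivative_eq_intros simp: divide_simps)
    ultimately have "((\<lambda>x. Re (L (of_real x * t)) - 96 * ln (1 - x * norm t)) has_real_derivative
        Re (t * deriv L ?s) - - (96 * (norm t / (1 - x * norm t)))) (at x)"
      by (rule DERIV_diff)
    moreover have "0 \<le> Re (t * deriv L ?s) - - (96 * (norm t / (1 - x * norm t)))"
    proof -
      have "norm (deriv L ?s) \<le> 96 / (1 - x * norm t)"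
        using dL[OF s] xt x by (simp add: norm_mult pos_le_divide_eq)
      then have "norm t * norm (deriv L ?s) \<le> norm t * (96 / (1 - x * norm t))"
        by (intro mult_left_mono) auto
      then have "norm (t * deriv L ?s) \<le> 96 * (norm t / (1 - x * norm t))"
        by (simp add: norm_mult mult.commute)
      then show ?thesis using abs_Re_le_cmod[of "t * deriv L ?s"] by linarith
    qed
    ultimately show "\<exists>y. ((\<lambda>x. Re (L (of_real x * t)) - 96 * ln (1 - x * norm t)) has_real_derivative y) (at x) \<and> 0 \<le> y"
      by blast
  qed simp
  then have "Re (L 0) + 96 * ln (1 - norm t) \<le> Re (L t)" by simp
  then have "exp (Re (L 0)) * exp (96 * ln (1 - norm t)) \<le> exp (Re (L t))"
    by (simp add: exp_add[symmetric])
  moreover have "exp (96 * ln (1 - norm t)) = (1 - norm t) ^ 96"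
    using exp_of_nat_mult[of 96 "ln (1 - norm t)"] t by simp
  moreover have "exp (Re (L 0)) = norm (f 0 - p)" "exp (Re (L t)) = norm (f t - p)"
    using L(2)[of 0] L(2)[of t] t norm_exp_eq_Re[of "L 0"] norm_exp_eq_Re[of "L t"] by simp_all
  ultimately show ?thesis by simp
qed

text \<open>The Schwarz lemma after rescaling domain and range. Applied to the Riemann map and its
  inverse it becomes the linear growth of both exterior maps.\<close>

lemma schwarz_linear_bound:
  assumes holo: "h holomorphic_on ball 0 r" and h0: "h 0 = 0"
    and b: "\<And>x. norm x < r \<Longrightarrow> norm (h x) < B" and x: "norm x < r"
  shows "norm (h x) \<le> B / r * norm x"
proof -
  have r: "0 < r" using x norm_ge_zero[of x] by linarith
  have B: "0 < B" using b[of 0] r h0 by simp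
  define k where "k = (\<lambda>\<xi>::complex. h (r * \<xi>) / B)"
  have inb: "norm (r * \<xi>) < r" if "norm \<xi> < 1" for \<xi> :: complex
    using that r by (simp add: norm_mult)
  have "(\<lambda>\<xi>::complex. h (r * \<xi>)) holomorphic_on ball 0 1"
    by (rule holomorphic_on_compose_gen[of "\<lambda>\<xi>. r * \<xi>" _ h, unfolded o_def, OF _ holo])
      (use inb in \<open>auto intro!: holomorphic_intros\<close>)
  then have "k holomorphic_on ball 0 1"
    unfolding k_def using B by (intro holomorphic_intros) auto
  moreover have "k 0 = 0" by (simp add: k_def h0)
  moreover have "norm (k \<xi>) < 1" if "norm \<xi> < 1" for \<xi>
    using b[OF inb[OF that]] B by (simp add: k_def norm_divide)
  moreover have "norm (x / r) < 1" using x r by (simp add: norm_divide)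
  ultimately have "norm (k (x / r)) \<le> norm (x / r)"
    by (rule Schwarz_Lemma(1))
  then show ?thesis using r B by (simp add: k_def norm_divide field_simps)
qed

text \<open>The Riemann map followed by the disc automorphism that moves the image of
  \<open>a\<close> to 0. With \<open>a\<close> the origin of the inverted domain, infinity will
  correspond to infinity.\<close>

lemma Riemann_mapping_centred:
  assumes S: "open S" "simply_connected S" "S \<noteq> UNIV" "a \<in> S"
  obtains g f where "g holomorphic_on S" "f holomorphic_on ball 0 1" "g a = 0"
    "\<And>x. x \<in> S \<Longrightarrow> norm (g x) < 1 \<and> f (g x) = x"
    "\<And>t. norm t < 1 \<Longrightarrow> f t \<in> S \<and> g (f t) = t"
proof -
  obtain F G where FG: "F holomorphic_on S" "G holomorphic_on ball 0 1"
    "\<And>z. z \<in> S \<Longrightarrow> F z \<in> ball 0 1 \<and> G (F z) = z"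
    "\<And>z. z \<in> ball 0 1 \<Longrightarrow> G z \<in> S \<and> F (G z) = z"
    using Riemann_mapping_theorem[of S] S by blast
  obtain h k where hk: "h (F a) = 0" "h holomorphic_on ball 0 1" "k holomorphic_on ball 0 1"
    "\<And>z. z \<in> ball 0 1 \<Longrightarrow> h z \<in> ball 0 1" "\<And>z. z \<in> ball 0 1 \<Longrightarrow> k z \<in> ball 0 1"
    "\<And>z. z \<in> ball 0 1 \<Longrightarrow> h (k z) = z" "\<And>z. z \<in> ball 0 1 \<Longrightarrow> k (h z) = z"
  proof (rule ball_biholomorphism_exists[of "F a"])
    show "F a \<in> ball 0 1" using FG(3)[OF S(4)] by simp
  qed (auto simp: image_subset_iff)
  show ?thesis
  proof (rule that[of "\<lambda>x. h (F x)" "\<lambda>t. G (k t)"])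
    have "F ` S \<subseteq> ball 0 1" "k ` ball 0 1 \<subseteq> ball 0 1" using FG(3) hk(5) by blast+
    then show "(\<lambda>x. h (F x)) holomorphic_on S" "(\<lambda>t. G (k t)) holomorphic_on ball 0 1"
      using holomorphic_on_compose_gen[OF FG(1) hk(2)] holomorphic_on_compose_gen[OF hk(3) FG(2)]
      by (simp_all add: o_def)
    show "h (F a) = 0" by (rule hk(1))
    show "norm (h (F x)) < 1 \<and> G (k (h (F x))) = x" if "x \<in> S" for x
      using FG(3)[OF that] hk(4)[of "F x"] hk(7)[of "F x"] by simp
    show "G (k t) \<in> S \<and> h (F (G (k t))) = t" if "norm t < 1" for t
      using hk(5)[of t] hk(6)[of t] FG(4)[of "k t"] that by simp
  qed
qed

text \<open>The domain is inverted at a point off its closure; the point at infinity becomes the origin.\<close>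

lemma inverted_exterior_domain:
  fixes U :: "complex set"
  assumes U: "open U" "connected U" and J: "frontier U = J" "compact J" "connected J"
    and R: "- ball 0 R \<subseteq> U" "0 < R"
    and \<epsilon>: "ball z0 \<epsilon> \<inter> U = {}" "0 < \<epsilon>"
  defines "\<Omega> \<equiv> {x. x = 0 \<or> z0 + 1 / x \<in> U}"
  shows "open \<Omega>" "simply_connected \<Omega>" "\<Omega> \<subseteq> cball 0 (1 / \<epsilon>)" "ball 0 (1 / (R + norm z0)) \<subseteq> \<Omega>"
proof -
  define k where "k = (\<lambda>x. z0 + 1 / x)"
  define h where "h = (\<lambda>z. 1 / (z - z0))"
  have hk: "h (k x) = x" if "x \<noteq> 0" for x using that by (simp add: h_def k_def)
  have kh: "k (h z) = z" if "z \<noteq> z0" for z using that by (simp add: h_def k_def)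
  have \<Omega>: "\<Omega> = insert 0 {x. k x \<in> U}" by (auto simp: \<Omega>_def k_def)
  have contk: "continuous_on (- {0}) k" unfolding k_def by (intro continuous_intros) auto
  have conth: "continuous_on (- {z0}) h" unfolding h_def by (intro continuous_intros) auto
  have zU: "z \<in> U" if "R \<le> norm z" for z using R(1) that by auto
  have far: "\<epsilon> \<le> norm (z - z0)" if "z \<in> U" for z
  proof (rule ccontr)
    assume "\<not> ?thesis"
    then have "z \<in> ball z0 \<epsilon> \<inter> U" using that by (simp add: dist_norm norm_minus_commute)
    then show False using \<epsilon>(1) by blast
  qed
  have z0U: "z0 \<notin> U" using far[of z0] \<epsilon>(2) by auto
  show small: "ball 0 (1 / (R + norm z0)) \<subseteq> \<Omega>"
  proof
    fix x :: complex assume x: "x \<in> ball 0 (1 / (R + norm z0))"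
    show "x \<in> \<Omega>"
    proof (cases "x = 0")
      case False
      have "0 < R + norm z0" using R(2) by (simp add: add_pos_nonneg)
      then have "R + norm z0 < 1 / norm x" using x False by (simp add: field_simps)
      moreover have "norm (1 / x) - norm z0 \<le> norm (k x)"
        unfolding k_def using norm_diff_ineq[of "1 / x" z0] by (simp add: add.commute)
      ultimately have "R \<le> norm (k x)" by (simp add: norm_divide)
      then show ?thesis unfolding \<Omega> using zU by auto
    qed (simp add: \<Omega>)
  qed
  have \<rho>: "0 < 1 / (R + norm z0)" using R(2) by (simp add: add_pos_nonneg)
  show sub: "\<Omega> \<subseteq> cball 0 (1 / \<epsilon>)"
  proof
    fix x assume x: "x \<in> \<Omega>"
    show "x \<in> cball 0 (1 / \<epsilon>)"
    proof (cases "x = 0")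
      case False
      then have "\<epsilon> \<le> norm (1 / x)" using x far[of "k x"] by (auto simp: \<Omega> k_def)
      then show ?thesis using False \<epsilon>(2) by (simp add: norm_divide field_simps)
    qed (use \<epsilon>(2) in auto)
  qed
  have pre: "\<Omega> - {0} = - {0} \<inter> k -` U" by (auto simp: \<Omega>)
  have im: "\<Omega> - {0} = h ` U"
  proof
    show "\<Omega> - {0} \<subseteq> h ` U"
    proof
      fix x assume "x \<in> \<Omega> - {0}"
      then have "x = h (k x)" "k x \<in> U" using hk[of x] by (auto simp: \<Omega>)
      then show "x \<in> h ` U" by blast
    qed
    show "h ` U \<subseteq> \<Omega> - {0}"
    proof
      fix x assume "x \<in> h ` U"
      then obtain z where z: "z \<in> U" "x = h z" by auto
      then have "z \<noteq> z0" using z0U by auto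
      then show "x \<in> \<Omega> - {0}" using z kh[of z] by (auto simp: \<Omega> h_def)
    qed
  qed
  \<comment> \<open>The two parts overlap, the disc standing for a neighbourhood of infinity;
    openness and connectedness are inherited from them.\<close>
  have un: "\<Omega> = h ` U \<union> ball 0 (1 / (R + norm z0))"
    using im small \<rho> by (auto simp: \<Omega>)
  have "open (\<Omega> - {0})"
    unfolding pre using continuous_open_preimage[OF contk _ U(1)] by auto
  then show op: "open \<Omega>"
    using un im by (metis open_Un open_ball)
  have "connected (h ` U)"
    by (rule connected_continuous_image[OF continuous_on_subset[OF conth] U(2)]) (use z0U in auto)
  moreover have "h ` U \<inter> ball 0 (1 / (R + norm z0)) \<noteq> {}"
  proof -
    let ?x = "complex_of_real (1 / (R + norm z0) / 2)"
    have "0 < R + norm z0" using R(2) by (simp add: add_pos_nonneg)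
    then have "?x \<in> ball 0 (1 / (R + norm z0))" "?x \<noteq> 0"
      by (auto simp: norm_divide field_simps simp flip: of_real_add of_real_mult)
    then have "?x \<in> h ` U \<inter> ball 0 (1 / (R + norm z0))"
      using small im by blast
    then show ?thesis by blast
  qed
  ultimately have con: "connected \<Omega>"
    unfolding un by (intro connected_Un) auto
  \<comment> \<open>For a bounded connected open set in the plane, simple connectivity amounts to a
    connected frontier, and inversion carries the connected set \<open>J\<close> onto it.\<close>
  have "frontier \<Omega> = h ` J"
  proof (intro subset_antisym subsetI)
    fix x assume "x \<in> frontier \<Omega>"
    then have x: "x \<in> closure \<Omega>" "x \<notin> \<Omega>"
      using op by (auto simp: frontier_def interior_open)
    then have "x \<noteq> 0" by (auto simp: \<Omega>)
    obtain xs where xs: "\<And>n::nat. xs n \<in> \<Omega>" "xs \<longlonglongrightarrow> x"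
      using x(1) closure_sequential by blast
    have ne: "\<forall>\<^sub>F n in sequentially. xs n \<noteq> 0"
      by (rule tendsto_imp_eventually_ne[OF xs(2) \<open>x \<noteq> 0\<close>])
    have "isCont k x" using \<open>x \<noteq> 0\<close> unfolding k_def by (intro continuous_intros) auto
    then have lim: "(\<lambda>n. k (xs n)) \<longlonglongrightarrow> k x"
      using isCont_tendsto_compose xs(2) by blast
    have "\<forall>\<^sub>F n in sequentially. k (xs n) \<in> closure U"
      using ne by eventually_elim (use xs(1) closure_subset in \<open>auto simp: \<Omega>\<close>)
    then have "k x \<in> closure U"
      by (rule Lim_in_closed_set[OF closed_closure _ _ lim]) simp
    moreover have "k x \<notin> U" using x(2) by (auto simp: \<Omega>)
    ultimately have "k x \<in> J" using J(1) U(1) by (auto simp: frontier_def interior_open)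
    then show "x \<in> h ` J" using hk[OF \<open>x \<noteq> 0\<close>] by (intro image_eqI[of _ _ "k x"]) auto
  next
    fix x assume "x \<in> h ` J"
    then obtain z where z: "z \<in> J" "x = h z" by auto
    then have zc: "z \<in> closure U" "z \<notin> U" using J(1) U(1) by (auto simp: frontier_def interior_open)
    have "z \<noteq> z0"
    proof
      assume "z = z0"
      then have "z0 \<in> ball z0 \<epsilon> \<inter> closure U" using zc(1) \<epsilon>(2) by simp
      then show False using \<epsilon>(1) open_Int_closure_eq_empty[OF open_ball, of z0 \<epsilon> U] by blast
    qed
    obtain zs where zs: "\<And>n::nat. zs n \<in> U" "zs \<longlonglongrightarrow> z"
      using zc(1) closure_sequential by blast
    have "isCont h z" using \<open>z \<noteq> z0\<close> unfolding h_def by (intro continuous_intros) auto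
    then have lim: "(\<lambda>n. h (zs n)) \<longlonglongrightarrow> h z"
      using isCont_tendsto_compose zs(2) by blast
    moreover have "h (zs n) \<in> \<Omega>" for n using zs(1)[of n] im by blast
    ultimately have "x \<in> closure \<Omega>"
      unfolding closure_sequential z(2) by (intro exI[of _ "\<lambda>n. h (zs n)"]) auto
    moreover have "x \<notin> \<Omega>"
      using kh[OF \<open>z \<noteq> z0\<close>] zc(2) \<open>z \<noteq> z0\<close> by (auto simp: \<Omega> z(2) h_def)
    ultimately show "x \<in> frontier \<Omega>" using op by (auto simp: frontier_def interior_open)
  qed
  moreover have "z0 \<notin> J"
  proof
    assume "z0 \<in> J"
    then have "z0 \<in> ball z0 \<epsilon> \<inter> closure U" using J(1) \<epsilon>(2) by (auto simp: frontier_def)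
    then show False using \<epsilon>(1) open_Int_closure_eq_empty[OF open_ball, of z0 \<epsilon> U] by blast
  qed
  then have "connected (h ` J)"
    by (intro connected_continuous_image[OF continuous_on_subset[OF conth] J(3)]) auto
  ultimately show "simply_connected \<Omega>"
    using simply_connected_eq_frontier_properties[OF op] con bounded_subset[OF bounded_cball sub] by simp
qed

text \<open>The Riemann maps of the inverted domain are conjugated by inversions. As they fix the
  origin, their linear bounds turn into linear growth at infinity; the last estimate is the omitted
  value bound at the inverted boundary point.\<close>

theorem exterior_conformal_map:
  fixes U :: "complex set"
  assumes U: "open U" "connected U" and J: "frontier U = J" "compact J" "connected J"
    and R: "- ball 0 R \<subseteq> U" "0 < R"
    and z0: "z0 \<notin> closure U"
  obtains \<phi> \<psi> K where "\<phi> holomorphic_on U" "\<psi> holomorphic_on - cball 0 1" "0 < K"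
    "\<And>z. z \<in> U \<Longrightarrow> 1 < norm (\<phi> z) \<and> \<psi> (\<phi> z) = z"
    "\<And>w. 1 < norm w \<Longrightarrow> \<psi> w \<in> U \<and> \<phi> (\<psi> w) = w"
    "\<And>z. z \<in> U \<Longrightarrow> norm (\<phi> z) \<le> K * (1 + norm z)"
    "\<And>w. 1 < norm w \<Longrightarrow> norm (\<psi> w) \<le> K * (1 + norm w)"
    "\<And>z p. z \<in> U \<Longrightarrow> p \<in> J \<Longrightarrow> (1 - 1 / norm (\<phi> z)) ^ 96 \<le> K * dist z p"
proof -
  obtain \<epsilon> where \<epsilon>: "0 < \<epsilon>" "ball z0 \<epsilon> \<inter> U = {}"
  proof -
    obtain e where "0 < e" "ball z0 e \<subseteq> - closure U"
      using z0 open_contains_ball[of "- closure U"] by auto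
    then show ?thesis using that[of e] closure_subset[of U] by blast
  qed
  define \<Omega> where "\<Omega> = {x. x = 0 \<or> z0 + 1 / x \<in> U}"
  define \<rho> where "\<rho> = 1 / (R + norm z0)"
  have \<rho>: "0 < \<rho>" unfolding \<rho>_def using R(2) by (simp add: add_pos_nonneg)
  note ied = inverted_exterior_domain[OF U J R \<epsilon>(2,1), folded \<Omega>_def \<rho>_def]
  have "\<Omega> \<noteq> UNIV"
    using bounded_subset[OF bounded_cball ied(3)] not_bounded_UNIV by auto
  moreover have "0 \<in> \<Omega>" by (simp add: \<Omega>_def)
  ultimately obtain g f where gf: "g holomorphic_on \<Omega>" "f holomorphic_on ball 0 1" "g 0 = 0"
    "\<And>x. x \<in> \<Omega> \<Longrightarrow> norm (g x) < 1 \<and> f (g x) = x"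
    "\<And>t. norm t < 1 \<Longrightarrow> f t \<in> \<Omega> \<and> g (f t) = t"
    using Riemann_mapping_centred[OF ied(1,2)] by metis
  have f0: "f 0 = 0" using gf(4)[OF \<open>0 \<in> \<Omega>\<close>] gf(3) by simp
  have fle: "norm (f t) \<le> 2 / \<epsilon> * norm t" if t: "norm t < 1" for t
  proof -
    \<comment> \<open>Doubling \<open>1 / \<epsilon>\<close> makes the bound strict, as the Schwarz
      lemma asks.\<close>
    have "norm (f s) < 2 / \<epsilon>" if "norm s < 1" for s
    proof -
      have "norm (f s) \<le> 1 / \<epsilon>" using gf(5)[OF that] ied(3) by auto
      also have "\<dots> < 2 / \<epsilon>" using \<epsilon>(1) by (simp add: divide_strict_right_mono)
      finally show ?thesis .
    qed
    then show ?thesis using schwarz_linear_bound[OF gf(2) f0, of "2 / \<epsilon>" t] t by simp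
  qed
  have gle: "norm (g x) \<le> 1 / \<rho> * norm x" if x: "x \<in> \<Omega>" for x
  proof (cases "norm x < \<rho>")
    case True
    have "g holomorphic_on ball 0 \<rho>" using gf(1) ied(4) by (rule holomorphic_on_subset)
    moreover have "norm (g y) < 1" if "norm y < \<rho>" for y
      using gf(4)[of y] ied(4) that by auto
    ultimately show ?thesis using schwarz_linear_bound[of g \<rho> 1 x] gf(3) True by simp
  next
    case False
    then have "1 \<le> 1 / \<rho> * norm x" using \<rho> by (simp add: field_simps)
    then show ?thesis using gf(4)[OF x] by linarith
  qed
  define \<phi> where "\<phi> = (\<lambda>z. 1 / g (1 / (z - z0)))"
  define \<psi> where "\<psi> = (\<lambda>w. z0 + 1 / f (1 / w))"
  have zz0: "z \<noteq> z0" if "z \<in> U" for z using z0 that closure_subset by blast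
  have x\<Omega>: "1 / (z - z0) \<in> \<Omega>" "1 / (z - z0) \<noteq> 0" if "z \<in> U" for z
    using that zz0[OF that] by (auto simp: \<Omega>_def)
  have gnz: "g x \<noteq> 0" if "x \<in> \<Omega>" "x \<noteq> 0" for x
    using gf(4)[OF that(1)] f0 that(2) by auto
  have fnz: "f t \<noteq> 0" if "norm t < 1" "t \<noteq> 0" for t
    using gf(5)[OF that(1)] gf(3) that(2) by auto
  have t1: "norm (1 / w) < 1" "1 / w \<noteq> 0" if "1 < norm w" for w :: complex
  proof -
    have "0 < norm w" using that by linarith
    then show "norm (1 / w) < 1" "1 / w \<noteq> 0" using that by (auto simp: norm_divide)
  qed
  have \<phi>U: "1 < norm (\<phi> z) \<and> \<psi> (\<phi> z) = z" if z: "z \<in> U" for z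
    using gf(4)[OF x\<Omega>(1)[OF z]] gnz[OF x\<Omega>[OF z]] by (simp add: \<phi>_def \<psi>_def norm_divide)
  have \<psi>V: "\<psi> w \<in> U \<and> \<phi> (\<psi> w) = w" if w: "1 < norm w" for w
    using gf(5)[OF t1(1)[OF w]] fnz[OF t1[OF w]] w by (auto simp: \<phi>_def \<psi>_def \<Omega>_def)
  have hol\<phi>: "\<phi> holomorphic_on U"
  proof -
    have "(\<lambda>z. g (1 / (z - z0))) holomorphic_on U"
      by (rule holomorphic_on_compose_gen[of "\<lambda>z. 1 / (z - z0)" _ g, unfolded o_def, OF _ gf(1)])
        (use x\<Omega> zz0 in \<open>auto intro!: holomorphic_intros\<close>)
    then show ?thesis unfolding \<phi>_def using gnz[OF x\<Omega>] by (intro holomorphic_intros) auto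
  qed
  have hol\<psi>: "\<psi> holomorphic_on - cball 0 1"
  proof -
    have "(\<lambda>w. f (1 / w)) holomorphic_on - cball 0 1"
      by (rule holomorphic_on_compose_gen[of "\<lambda>w. 1 / w" _ f, unfolded o_def, OF _ gf(2)])
        (use t1 in \<open>auto intro!: holomorphic_intros\<close>)
    then show ?thesis unfolding \<psi>_def using fnz[OF t1] by (intro holomorphic_intros) auto
  qed
  have inv_le: "1 / b \<le> k * (1 / a)" if "a \<le> k * b" "0 < a" "0 < b" for a b k :: real
    using that by (simp add: field_simps)
  define K where "K = 1 + norm z0 + 2 / \<epsilon> * (1 + norm z0) + 1 / \<rho>"
  have pos: "0 \<le> 2 / \<epsilon>" "0 \<le> norm z0" "0 \<le> 2 / \<epsilon> * norm z0" "0 \<le> 1 / \<rho>" using \<epsilon>(1) \<rho> by auto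
  have K: "1 \<le> K" "2 / \<epsilon> \<le> K" "norm z0 \<le> K" "1 / \<rho> \<le> K" "2 / \<epsilon> * (1 + norm z0) \<le> K"
    using pos unfolding K_def distrib_left by linarith+
  show ?thesis
  proof (rule that[OF hol\<phi> hol\<psi> _ \<phi>U \<psi>V])
    show "0 < K" using K(1) by simp
  next
    fix z assume z: "z \<in> U"
    let ?x = "1 / (z - z0)"
    have "norm ?x \<le> 2 / \<epsilon> * norm (g ?x)"
      using fle[of "g ?x"] gf(4)[OF x\<Omega>(1)[OF z]] by simp
    moreover have "0 < norm ?x" "0 < norm (g ?x)"
      using gnz[OF x\<Omega>[OF z]] x\<Omega>(2)[OF z] by auto
    ultimately have "1 / norm (g ?x) \<le> 2 / \<epsilon> * (1 / norm ?x)"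
      by (rule inv_le)
    then have "norm (\<phi> z) \<le> 2 / \<epsilon> * norm (z - z0)"
      by (simp add: \<phi>_def norm_divide)
    also have "\<dots> \<le> 2 / \<epsilon> * ((1 + norm z0) * (1 + norm z))"
    proof (rule mult_left_mono[OF _ pos(1)])
      have "norm (z - z0) \<le> norm z + norm z0" by (rule norm_triangle_ineq4)
      also have "\<dots> \<le> (1 + norm z0) * (1 + norm z)" by (simp add: algebra_simps)
      finally show "norm (z - z0) \<le> (1 + norm z0) * (1 + norm z)" .
    qed
    also have "\<dots> \<le> K * (1 + norm z)"
      unfolding mult.assoc[symmetric] using K(5) by (intro mult_right_mono) auto
    finally show "norm (\<phi> z) \<le> K * (1 + norm z)" .
  next
    fix w :: complex assume w: "1 < norm w"
    let ?t = "1 / w"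
    have "norm ?t \<le> 1 / \<rho> * norm (f ?t)"
      using gle[of "f ?t"] gf(5)[OF t1(1)[OF w]] by simp
    moreover have "0 < norm ?t" "0 < norm (f ?t)"
      using fnz[OF t1[OF w]] t1(2)[OF w] by auto
    ultimately have "1 / norm (f ?t) \<le> 1 / \<rho> * (1 / norm ?t)"
      by (rule inv_le)
    then have "1 / norm (f ?t) \<le> 1 / \<rho> * norm w"
      by (simp add: norm_divide)
    moreover have "norm (\<psi> w) \<le> norm z0 + 1 / norm (f ?t)"
      unfolding \<psi>_def using norm_triangle_ineq[of z0 "1 / f ?t"] by (simp add: norm_divide)
    moreover have "1 / \<rho> * norm w \<le> K * norm w" using K(4) by (intro mult_right_mono) auto
    ultimately show "norm (\<psi> w) \<le> K * (1 + norm w)"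
      using K(3) by (simp add: distrib_left)
  next
    fix z p assume z: "z \<in> U" and p: "p \<in> J"
    define x where "x = 1 / (z - z0)"
    define y where "y = 1 / (p - z0)"
    define t where "t = g x"
    have x: "x \<in> \<Omega>" "x \<noteq> 0" using x\<Omega>[OF z] by (auto simp: x_def)
    have t: "norm t < 1" "f t = x" "t \<noteq> 0" using gf(4)[OF x(1)] gnz[OF x] by (auto simp: t_def)
    have "p \<in> closure U" "p \<notin> U" using p J(1) U(1) by (auto simp: frontier_def interior_open)
    then have "p \<noteq> z0" using z0 by auto
    then have y: "y \<noteq> 0" "y \<notin> \<Omega>" using \<open>p \<notin> U\<close> by (auto simp: y_def \<Omega>_def)
    have "y \<notin> f ` ball 0 1" using gf(5) y(2) by auto
    moreover have "inj_on f (ball 0 1)" by (rule inj_on_inverseI[of _ g]) (use gf(5) in auto)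
    ultimately have "norm (f 0 - y) * (1 - norm t) ^ 96 \<le> norm (f t - y)"
      using univalent_omitted_value_lower_bound[OF gf(2) _ _ t(1)] by simp
    then have 1: "norm y * (1 - norm t) ^ 96 \<le> norm (x - y)" by (simp add: f0 t(2))
    \<comment> \<open>Inversion distorts distances by \<open>norm x\<close> and
      \<open>norm y\<close>: the latter cancels against \<open>norm (f 0 - y)\<close>, the former is
      bounded because \<open>\<Omega>\<close> is.\<close>
    have "x - y = (p - z) * x * y"
      using \<open>p \<noteq> z0\<close> zz0[OF z] by (simp add: x_def y_def field_simps)
    then have "norm (x - y) = dist z p * norm x * norm y"
      by (simp add: norm_mult dist_norm norm_minus_commute)
    then have "(1 - norm t) ^ 96 \<le> norm x * dist z p"
      using 1 y(1) by (simp add: mult_ac)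
    also have "\<dots> \<le> K * dist z p"
    proof (rule mult_right_mono)
      have "norm x \<le> 1 / \<epsilon>" using x(1) ied(3) by auto
      also have "\<dots> \<le> 2 / \<epsilon>" using \<epsilon>(1) by (simp add: divide_right_mono)
      finally show "norm x \<le> K" using K(2) by simp
    qed simp
    also have "norm t = 1 / norm (\<phi> z)" by (simp add: \<phi>_def t_def x_def norm_divide)
    finally show "(1 - 1 / norm (\<phi> z)) ^ 96 \<le> K * dist z p" .
  qed
qed

section \<open>Quasicircle domains\<close>

lemma bdist_exterior_disc:
  fixes w :: complex
  assumes "1 < norm w"
  shows "bdist (- cball 0 1) w = min 1 (norm w - 1)"
proof -
  have "infdist w (cball 0 1) = norm w - 1"
  proof (rule antisym)
    have "w = norm w *\<^sub>R sgn w"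
      by (cases "w = 0") (auto simp: sgn_div_norm)
    then have "w - sgn w = (norm w - 1) *\<^sub>R sgn w"
      by (metis scaleR_left_diff_distrib scaleR_one)
    then have "dist w (sgn w) = norm w - 1"
      using assms by (cases "w = 0") (auto simp: dist_norm norm_sgn)
    then show "infdist w (cball 0 1) \<le> norm w - 1"
      using infdist_le[of "sgn w" "cball 0 1" w] by (simp add: norm_sgn)
    obtain q where q: "q \<in> cball (0::complex) 1" "infdist w (cball 0 1) = dist w q"
      using infdist_attains_inf[of "cball (0::complex) 1" w] by auto
    then show "norm w - 1 \<le> infdist w (cball 0 1)"
      using norm_triangle_ineq2[of w q] by (simp add: dist_norm)
  qed
  then show ?thesis by (simp add: bdist_def)
qed

text \<open>The segment to a nearest point of the complement crosses the frontier; a value below 1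
  is the true distance and not the cut-off.\<close>

lemma bdist_attained_on_frontier:
  fixes U :: "complex set"
  assumes "open U" "z \<in> U" "bdist U z < 1" "U \<noteq> UNIV"
  obtains p where "p \<in> frontier U" "dist z p \<le> bdist U z"
proof -
  obtain q where q: "q \<in> - U" "infdist z (- U) = dist z q"
    using infdist_attains_inf[of "- U" z] assms by (auto simp: closed_Compl)
  have "closed_segment z q \<inter> frontier U \<noteq> {}"
    by (rule connected_Int_frontier) (use assms(2) q(1) in auto)
  then obtain p where p: "p \<in> closed_segment z q" "p \<in> frontier U" by blast
  have "dist z p \<le> dist z q" using segment_bound(1)[OF p(1)] by (simp add: dist_norm norm_minus_commute)
  then show ?thesis using that p(2) assms(3) q(2) by (auto simp: bdist_def)
qed

theorem theorem4p3:
  fixes U :: "complex set"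
  assumes "open U" and "connected U" and "\<not> bounded U"
    and "bounded (frontier U)" and "quasicircle (frontier U)"
  shows "schwartz_equivalent U (- closure (ball 0 1))"
proof -
  define J where "J = frontier U"
  have cJ: "compact J" unfolding J_def using assms(4) by (simp add: compact_eq_bounded_closed)
  have qJ: "quasicircle J" using assms(5) by (simp add: J_def)
  obtain \<gamma> where \<gamma>: "simple_path \<gamma>" "pathfinish \<gamma> = pathstart \<gamma>" "path_image \<gamma> = J"
    using compact_jordan_curve_imp_simple_path[OF cJ] qJ unfolding quasicircle_def by metis
  have conJ: "connected J" and neJ: "J \<noteq> {}"
    using connected_simple_path_image[OF \<gamma>(1)] path_image_nonempty[of \<gamma>] \<gamma>(3) by auto
  have UJ: "U \<inter> J = {}" using assms(1) by (auto simp: J_def frontier_def interior_open)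
  have ins: "inside J \<noteq> {}" "open (inside J)"
    using Jordan_inside_outside[OF \<gamma>(1,2)] \<gamma>(3) by auto
  \<comment> \<open>\<open>U\<close> is connected, unbounded and misses \<open>J\<close>, so it
    meets no bounded component of the complement. The interior of the curve thus provides a centre
    of inversion off the closure of \<open>U\<close>.\<close>
  have "inside J \<inter> U = {}"
  proof -
    have False if x: "x \<in> inside J" "x \<in> U" for x
    proof -
      have "U \<subseteq> connected_component_set (- J) x"
        by (rule connected_component_maximal[OF x(2) assms(2)]) (use UJ in auto)
      then show False using x(1) assms(3) bounded_subset by (auto simp: inside_def)
    qed
    then show ?thesis by blast
  qed
  then have "inside J \<inter> closure U = {}" using ins(2) open_Int_closure_eq_empty by blast
  then obtain z0 where z0: "z0 \<notin> closure U" using ins(1) by blast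
  have neU: "U \<noteq> UNIV" using z0 closure_subset by blast
  have ext: "- ball 0 R \<subseteq> U" if R: "J \<subseteq> ball 0 R" for R
  proof (rule ccontr)
    assume "\<not> ?thesis"
    then have "- ball 0 R - U \<noteq> {}" by blast
    moreover have "- ball 0 R \<inter> U \<noteq> {}"
      using assms(3) bounded_subset[OF bounded_ball, of U 0 R] by blast
    moreover have "connected (- ball (0::complex) R)"
      by (rule connected_complement_bounded_convex) auto
    ultimately have "- ball 0 R \<inter> frontier U \<noteq> {}"
      by (intro connected_Int_frontier)
    then show False using R by (auto simp: J_def)
  qed
  obtain R where R: "0 < R" "J \<subseteq> ball 0 R"
    using bounded_subset_ballD[OF compact_imp_bounded[OF cJ], of 0] by auto
  obtain \<phi> \<psi> K where K: "\<phi> holomorphic_on U" "\<psi> holomorphic_on - cball 0 1" "0 < K"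
    "\<And>z. z \<in> U \<Longrightarrow> 1 < norm (\<phi> z) \<and> \<psi> (\<phi> z) = z"
    "\<And>w. 1 < norm w \<Longrightarrow> \<psi> w \<in> U \<and> \<phi> (\<psi> w) = w"
    "\<And>z. z \<in> U \<Longrightarrow> norm (\<phi> z) \<le> K * (1 + norm z)"
    "\<And>w. 1 < norm w \<Longrightarrow> norm (\<psi> w) \<le> K * (1 + norm w)"
    "\<And>z p. z \<in> U \<Longrightarrow> p \<in> J \<Longrightarrow> (1 - 1 / norm (\<phi> z)) ^ 96 \<le> K * dist z p"
    by (rule exterior_conformal_map[OF assms(1,2) J_def[symmetric] cJ conJ ext[OF R(2)] R(1) z0], rule that)
  obtain C where C: "1 \<le> C" "bounded_turning C J"
    using quasicircle_bounded_turning[OF cJ qJ] by metis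
  \<comment> \<open>For \<open>norm w < 2\<close> the growth bound places \<open>\<psi> w\<close>
    within radius \<open>3 * K\<close>, where the lower growth estimate is to hold.\<close>
  define R' where "R' = max R (3 * K)"
  have R': "J \<subseteq> ball 0 R'" using R(2) by (auto simp: R'_def)
  obtain L M where LM: "0 < L" "\<And>w. w \<in> U \<Longrightarrow> norm w < R' \<Longrightarrow> infdist w J ^ M \<le> L * (norm (\<phi> w) - 1)"
  proof (rule bounded_turning_lower_growth[OF cJ C(2,1) R' neJ assms(1,2) UJ _ ext[OF R'] K(1)])
    show "frontier U \<subseteq> J" by (simp add: J_def)
    show "1 < norm (\<phi> z)" if "z \<in> U" for z using K(4)[OF that] by simp
  qed (rule that)
  let ?V = "- cball (0::complex) 1"
  define A where "A = 1 + K + 2 ^ 96 * K + L"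
  have A: "1 \<le> A" "K \<le> A" "2 ^ 96 * K \<le> A" "L \<le> A"
    using K(3) LM(1) by (auto simp: A_def)
  have "0 \<notin> ?V" by simp
  then have V: "open ?V" "?V \<noteq> UNIV" using open_Compl[OF closed_cball] by blast+
  have boundary_\<phi>: "bdist ?V (\<phi> z) ^ 96 \<le> A * bdist U z" if z: "z \<in> U" for z
  proof (cases "bdist U z < 1")
    case True
    obtain p where p: "p \<in> J" "dist z p \<le> bdist U z"
      using bdist_attained_on_frontier[OF assms(1) z True neU] unfolding J_def by metis
    have s: "1 < norm (\<phi> z)" using K(4)[OF z] by simp
    then have s0: "0 < norm (\<phi> z)" by linarith
    \<comment> \<open>Passes from the distance in the inverted picture to that in the exterior: a
      direct computation up to norm 2, and beyond it the cut of \<open>bdist\<close> at 1.\<close>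
    have "bdist ?V (\<phi> z) \<le> 2 * (1 - 1 / norm (\<phi> z))"
    proof (cases "norm (\<phi> z) \<le> 2")
      case True
      have "norm (\<phi> z) - 1 = norm (\<phi> z) * (1 - 1 / norm (\<phi> z))"
        using s0 by (simp add: field_simps)
      also have "\<dots> \<le> 2 * (1 - 1 / norm (\<phi> z))"
        using True s s0 by (intro mult_right_mono) (simp_all del: zero_less_norm_iff)
      finally have "norm (\<phi> z) - 1 \<le> 2 * (1 - 1 / norm (\<phi> z))" .
      then show ?thesis using s by (simp add: bdist_exterior_disc)
    next
      case False
      then have "1 \<le> 2 * (1 - 1 / norm (\<phi> z))" using s0 by (simp add: field_simps)
      then show ?thesis using s by (simp add: bdist_exterior_disc)
    qed
    then have "bdist ?V (\<phi> z) ^ 96 \<le> (2 * (1 - 1 / norm (\<phi> z))) ^ 96"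
      by (intro power_mono bdist_nonneg)
    also have "\<dots> = 2 ^ 96 * (1 - 1 / norm (\<phi> z)) ^ 96" by (rule power_mult_distrib)
    also have "\<dots> \<le> 2 ^ 96 * (K * dist z p)"
      by (intro mult_left_mono K(8) z p) auto
    also have "\<dots> = (2 ^ 96 * K) * dist z p" by simp
    also have "\<dots> \<le> A * bdist U z"
      by (intro mult_mono A(3) p) (use A(1) in auto)
    finally show ?thesis .
  next
    case False
    then have "bdist U z = 1" using bdist_le_1[of U z] by simp
    then show ?thesis using power_le_one[OF bdist_nonneg bdist_le_1, of ?V "\<phi> z" 96] A(1) by simp
  qed
  have boundary_\<psi>: "bdist U (\<psi> w) ^ M \<le> A * bdist ?V w" if w: "1 < norm w" for w
  proof (cases "norm w < 2")
    case True
    define z where "z = \<psi> w"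
    have z: "z \<in> U" "\<phi> z = w" using K(5)[OF w] by (auto simp: z_def)
    have "norm z \<le> K * (1 + norm w)" using K(7)[OF w] by (simp add: z_def)
    also have "\<dots> < K * 3" using True K(3) by (intro mult_strict_left_mono) auto
    finally have "norm z < R'" by (simp add: R'_def)
    have "J \<subseteq> - U" using UJ by blast
    then have "infdist z (- U) \<le> infdist z J" by (rule infdist_mono[OF _ neJ])
    then have "bdist U z ^ M \<le> infdist z J ^ M"
      by (intro power_mono bdist_nonneg) (auto simp: bdist_def)
    also have "\<dots> \<le> L * (norm w - 1)" using LM(2)[OF z(1) \<open>norm z < R'\<close>] z(2) by simp
    also have "\<dots> \<le> A * bdist ?V w"
      using w True A(4) by (simp add: bdist_exterior_disc mult_right_mono)
    finally show ?thesis by (simp add: z_def)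
  next
    case False
    then have "bdist ?V w = 1" using w by (simp add: bdist_exterior_disc)
    then show ?thesis using power_le_one[OF bdist_nonneg bdist_le_1, of U "\<psi> w" M] A(1) by simp
  qed
  have mono: "x \<le> K * (1 + y) \<Longrightarrow> 0 \<le> y \<Longrightarrow> x \<le> A * (1 + y)" for x y
    using mult_right_mono[OF A(2), of "1 + y"] by linarith
  have "schwartz_equivalent U ?V"
  proof (rule schwartz_equivalent_tame_holomorphic)
    show "tame_holomorphic_map U ?V \<phi> A 96"
    proof
      show "\<phi> z \<in> ?V" if "z \<in> U" for z using K(4)[OF that] by simp
      show "norm (\<phi> z) \<le> A * (1 + norm z)" if "z \<in> U" for z
        by (rule mono[OF K(6)[OF that]]) simp
      \<comment> \<open>The lower bound on the growth of a map is the upper bound for its inverse,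
        taken at the image point.\<close>
      show "norm z \<le> A * (1 + norm (\<phi> z))" if "z \<in> U" for z
        using K(4)[OF that] K(7)[of "\<phi> z"] by (intro mono) auto
    qed (use assms(1) neU V K(1) A(1) boundary_\<phi> in auto)
    show "tame_holomorphic_map ?V U \<psi> A M"
    proof
      show "\<psi> w \<in> U" if "w \<in> ?V" for w using K(5)[of w] that by simp
      show "norm (\<psi> w) \<le> A * (1 + norm w)" if "w \<in> ?V" for w
        by (rule mono[OF K(7)]) (use that in auto)
      show "norm w \<le> A * (1 + norm (\<psi> w))" if "w \<in> ?V" for w
        using K(5)[of w] K(6)[of "\<psi> w"] that by (intro mono) auto
    qed (use assms(1) neU V K(2) A(1) boundary_\<psi> in auto)
    show "\<psi> (\<phi> z) = z" if "z \<in> U" for z using K(4)[OF that] by simp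
    show "\<phi> (\<psi> w) = w" if "w \<in> ?V" for w using K(5)[of w] that by simp
  qed
  then show ?thesis by simp
qed

end
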